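(* Let $n\ge 4$ and let $\Gamma$ be a type II quiver of mutation type $D_n$, with $\Gamma^{(1)}$ of mutation type $A_m$ and $\Gamma^{(2)}$ of mutation type $A_{n-m-2}$ ($1\le m\le n-3$), labelled by the type II labelling procedure. Let $\Phi$ be the root system of type $D_n$ with simple system $\Pi=\{\alpha_1,\ldots,\alpha_n\}$, and identify vertices with their labels. Then the set $\{\beta_i : i\in\Gamma_0\}\subseteq\Phi$ given by $$\beta_i=\begin{cases}\alpha_i+\ldots+\alpha_{i+a} & \text{if } i \text{ is a primary vertex and } i+a \text{ is the complementary vertex corresponding to } i,\\ \alpha_{m+1}+\alpha_{m+2}+\ldots+\alpha_{n-2}+\alpha_{n-1} & \text{if } i=n-1,\\ \alpha_{m+1}+\alpha_{m+2}+\ldots+\alpha_{n-2}+\alpha_{n} & \text{if } i=n,\\ \alpha_i & \text{otherwise}\end{cases}$$ is a companion basis for $\Gamma$.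
   Context: **Mutation type.** For a simply-laced Dynkin diagram $\Delta$, a quiver is of mutation type $\Delta$ if it is obtained by a finite sequence of (Fomin--Zelevinsky) quiver mutations from a quiver whose underlying graph is $\Delta$. $\Gamma_0$ denotes the vertex set of $\Gamma$. **Root system.** $\Phi$ is the root system of type $D_n$, with inner product $(\cdot,\cdot)$ normalized so that $(\alpha,\alpha)=2$ for all roots $\alpha$; the simple roots are numbered so that the Dynkin diagram is the chain $1 - 2 - \cdots - (n-2)$ with $n-2$ additionally joined to both $n-1$ and $n$. **Companion basis.** A companion basis for a quiver $\Gamma$ of mutation type $\Delta$ is a subset $\{\gamma_x : x\in\Gamma_0\}\subseteq\Phi$ (with $\Phi$ the root system of type $\Delta$) whose elements form a $\mathbb{Z}$-basis of the root lattice $\mathbb{Z}\Phi$ and such that for all distinct $x,y\in\Gamma_0$, $|(\gamma_x,\gamma_y)|$ equals the number of edges joining $x$ and $y$ in the underlying unoriented graph of $\Gamma$. **Structure of type $A$ quivers (known facts making the definitions below meaningful).** A quiver $Q$ of mutation type $A_k$ is connected; the only cycles in its underlying graph are 3-cycles, each of which is cyclically oriented in $Q$; every vertex has valency at most four and lies on at most two 3-cycles. An end vertex is a vertex that has valency zero, or valency one, or has valency two and belongs to a cyclically oriented 3-cycle; if $k\ge 2$ there are at least two end vertices. A string in $Q$ is a reduced walk in $Q$ that does not contain two consecutive arrows of any given 3-cycle; for any two vertices $i,j$ there is a unique string from $i$ to $j$ (trivial if $i=j$), and it visits no vertex twice. Let $p$ be a string from $i$ to $j$. For a 3-cycle with two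 vertices appearing in $p$, the first of these met when moving along $p$ from $i$ to $j$ is a primary vertex relative to $p$, the second is the secondary vertex corresponding to it relative to $p$, and the vertex of the 3-cycle not on $p$ is the complementary vertex corresponding to it relative to $p$. If $x,y,z$ are the vertices of a 3-cycle, the subquiver of $Q$ rooted at $x$ is the full subquiver on all vertices that can be reached on strings starting at $x$ which do not pass through $y$ or $z$; it is again a quiver of mutation type $A$, and $x$ is an end vertex of it. **Type $A$ labelling procedure.** The input is a quiver $Q$ of mutation type $A_k$ and an ordered pair of end vertices of $Q$, distinct if $k\ge 2$. If $k=1$, label the vertex $1$. If $k\ge 2$ with pair $(e,f)$, label $e$ by $1$ and let $p$ be the string from $e$ to $f$; move along $p$ from $e$ to $f$. If the current vertex has label $\ell$ and is not a primary vertex relative to $p$, label the next vertex of $p$ by $\ell+1$. If the current vertex has label $\ell$ and is a primary vertex relative to $p$ with corresponding complementary vertex $z$, let $Q'$ be the subquiver of $Q$ rooted at $z$ and let $a$ be its number of vertices; choose an end vertex $z'$ of $Q'$, distinct from $z$ if $a>1$; recursively label $Q'$ with $1,\ldots,a$ using the ordered pair $(z',z)$; add $\ell$ to each of these labels and assign the results to the corresponding vertices of $Q$; then label the next vertex on $p$ (the corresponding secondary vertex) by $\ell+a+1$. Continue until $f$ is labelled; it gets the label $k$. **Type II quivers.** Let $\Gamma^{(0)}$ be the quiver with four vertices $c_1,c_2,a,b$ and exactly the five arrows $c_1\to a$, $a\to c_2$, $c_1\to b$, $b\to c_2$, $c_2\to c_1$ (two oriented 3-cycles sharing the arrow $c_2\to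 c_1$). $\Gamma$ is of type II if it is obtained from a disjoint union $\Gamma^{(0)}\sqcup\Gamma^{(1)}\sqcup\Gamma^{(2)}$, where $\Gamma^{(1)}$ and $\Gamma^{(2)}$ are quivers of mutation types $A_m$ and $A_{n-m-2}$ respectively for some $1\le m\le n-3$, by identifying some end vertices $v_1$ of $\Gamma^{(1)}$ and $v_2$ of $\Gamma^{(2)}$ with $c_1$ and $c_2$ respectively. **Labelling of a type II quiver.** Choose an ordered pair of end vertices (distinct if possible) of $\Gamma^{(1)}$ with $v_1$ the second vertex in the pair, apply the type $A$ labelling procedure to $\Gamma^{(1)}$ (so $v_1$ gets label $m$), and use these labels in $\Gamma$. Choose an ordered pair of end vertices (distinct if possible) of $\Gamma^{(2)}$ with $v_2$ the first vertex in the pair, apply the type $A$ labelling procedure to $\Gamma^{(2)}$, add $m$ to each label (giving labels $m+1,\ldots,n-2$, with $v_2$ labelled $m+1$), and use these labels in $\Gamma$. Label the remaining two vertices $a,b$ by $n-1$ and $n$. **Vertex types in the labelled quiver.** If the vertices of a 3-cycle of $\Gamma^{(1)}$ or of $\Gamma^{(2)}$ have labels $i<j<k$, then $i$ is called a primary vertex, $j$ a complementary vertex (the complementary vertex corresponding to $i$), and $k$ a secondary vertex. A vertex of $\Gamma$ is primary (resp. complementary, secondary) if it is so in $\Gamma^{(1)}$ or $\Gamma^{(2)}$. *)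

theory Defs
  imports "HOL-Analysis.Analysis"
begin

section \<open>Quivers and mutation\<close>

text \<open>A quiver is given by its vertex set and the number of arrows from \<open>x\<close> to \<open>y\<close>;
  the names of the individual arrows play no role for mutation.\<close>

record 'v quiver =
  qverts :: "'v set"
  arrows :: "'v \<Rightarrow> 'v \<Rightarrow> nat"

text \<open>Fomin--Zelevinsky mutation is defined for finite quivers without loops and 2-cycles.\<close>

definition is_quiver :: "'v quiver \<Rightarrow> bool" where
  "is_quiver Q \<longleftrightarrow>
     finite (qverts Q) \<and>
     (\<forall>x y. arrows Q x y \<noteq> 0 \<longrightarrow> x \<in> qverts Q \<and> y \<in> qverts Q) \<and>
     (\<forall>x. arrows Q x x = 0) \<and>
     (\<forall>x y. arrows Q x y = 0 \<or> arrows Q y x = 0)"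

definition num_edges :: "'v quiver \<Rightarrow> 'v \<Rightarrow> 'v \<Rightarrow> nat" where
  "num_edges Q x y = arrows Q x y + arrows Q y x"

text \<open>Mutation at \<open>k\<close>: an arrow \<open>x \<rightarrow> y\<close> is added for every path \<open>x \<rightarrow> k \<rightarrow> y\<close>, the arrows at \<open>k\<close>
  are reversed, and a maximal set of 2-cycles is cancelled. The cancellation is the truncated
  subtraction on \<^typ>\<open>nat\<close>.\<close>

definition mutate :: "'v \<Rightarrow> 'v quiver \<Rightarrow> 'v quiver" where
  "mutate k Q =
     \<lparr>qverts = qverts Q,
      arrows = (\<lambda>x y. if x = k \<or> y = k then arrows Q y x
                      else (arrows Q x y + arrows Q x k * arrows Q k y)
                         - (arrows Q y x + arrows Q y k * arrows Q k x))\<rparr>"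

text \<open>A simply-laced Dynkin diagram is given by its number \<open>k\<close> of vertices, which are
  \<open>1, \<dots>, k\<close>, and its set of edges, each a two-element set.\<close>

definition dynkin_A :: "nat \<Rightarrow> nat set set" where
  "dynkin_A k = {{t, t + 1} | t. 1 \<le> t \<and> t + 1 \<le> k}"

definition dynkin_D :: "nat \<Rightarrow> nat set set" where
  "dynkin_D n = {{t, t + 1} | t. 1 \<le> t \<and> t + 1 \<le> n - 2} \<union> {{n - 2, n - 1}, {n - 2, n}}"

definition has_underlying_graph :: "nat \<Rightarrow> nat set set \<Rightarrow> 'v quiver \<Rightarrow> bool" where
  "has_underlying_graph k E Q \<longleftrightarrow>
     (\<exists>f. bij_betw f {1..k} (qverts Q) \<and>
          (\<forall>i\<in>{1..k}. \<forall>j\<in>{1..k}. num_edges Q (f i) (f j) = (if {i, j} \<in> E then 1 else 0)))"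

definition mutation_type :: "nat \<Rightarrow> nat set set \<Rightarrow> 'v quiver \<Rightarrow> bool" where
  "mutation_type k E Q \<longleftrightarrow>
     (\<exists>Q0. is_quiver Q0 \<and> has_underlying_graph k E Q0 \<and>
           (\<lambda>P P'. \<exists>v\<in>qverts P. P' = mutate v P)\<^sup>*\<^sup>* Q0 Q)"

abbreviation mutation_type_A :: "nat \<Rightarrow> 'v quiver \<Rightarrow> bool" where
  "mutation_type_A k \<equiv> mutation_type k (dynkin_A k)"

abbreviation mutation_type_D :: "nat \<Rightarrow> 'v quiver \<Rightarrow> bool" where
  "mutation_type_D n \<equiv> mutation_type n (dynkin_D n)"


section \<open>Strings and end vertices\<close>

definition three_cycle :: "'v quiver \<Rightarrow> 'v set \<Rightarrow> bool" where
  "three_cycle Q T \<longleftrightarrow>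
     (\<exists>x y z. T = {x, y, z} \<and> x \<noteq> y \<and> y \<noteq> z \<and> x \<noteq> z \<and>
              arrows Q x y > 0 \<and> arrows Q y z > 0 \<and> arrows Q z x > 0)"

definition valency :: "'v quiver \<Rightarrow> 'v \<Rightarrow> nat" where
  "valency Q x = (\<Sum>y\<in>qverts Q. num_edges Q x y)"

definition end_vertex :: "'v quiver \<Rightarrow> 'v \<Rightarrow> bool" where
  "end_vertex Q x \<longleftrightarrow>
     x \<in> qverts Q \<and>
     (valency Q x = 0 \<or> valency Q x = 1 \<or>
      (valency Q x = 2 \<and> (\<exists>T. three_cycle Q T \<and> x \<in> T)))"

text \<open>In a quiver of mutation type \<open>A\<close> there is at most one arrow between two vertices, so a walk
  is determined by its list of vertices. The two conditions on \<open>p ! i\<close> and \<open>p ! (i + 2)\<close> say that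
  the walk is reduced, and that it has no two consecutive arrows in one 3-cycle.\<close>

definition is_string :: "'v quiver \<Rightarrow> 'v list \<Rightarrow> bool" where
  "is_string Q p \<longleftrightarrow>
     p \<noteq> [] \<and> set p \<subseteq> qverts Q \<and>
     (\<forall>i. i + 1 < length p \<longrightarrow> num_edges Q (p ! i) (p ! (i + 1)) > 0) \<and>
     (\<forall>i. i + 2 < length p \<longrightarrow>
        p ! i \<noteq> p ! (i + 2) \<and> \<not> three_cycle Q {p ! i, p ! (i + 1), p ! (i + 2)})"

definition string_from_to :: "'v quiver \<Rightarrow> 'v \<Rightarrow> 'v \<Rightarrow> 'v list \<Rightarrow> bool" where
  "string_from_to Q x y p \<longleftrightarrow> is_string Q p \<and> hd p = x \<and> last p = y"

text \<open>Relative to the string \<open>p\<close>: \<open>x\<close> is primary, with corresponding complementary vertex \<open>z\<close>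
  and secondary vertex \<open>y\<close>.\<close>

definition primary_along :: "'v quiver \<Rightarrow> 'v list \<Rightarrow> 'v \<Rightarrow> 'v \<Rightarrow> 'v \<Rightarrow> bool" where
  "primary_along Q p x z y \<longleftrightarrow>
     three_cycle Q {x, y, z} \<and> z \<notin> set p \<and>
     (\<exists>i j. i < j \<and> j < length p \<and> p ! i = x \<and> p ! j = y)"

definition full_subquiver :: "'v quiver \<Rightarrow> 'v set \<Rightarrow> 'v quiver" where
  "full_subquiver Q S =
     \<lparr>qverts = S, arrows = (\<lambda>x y. if x \<in> S \<and> y \<in> S then arrows Q x y else 0)\<rparr>"

text \<open>The subquiver rooted at \<open>x\<close>, where \<open>x, y, z\<close> are the vertices of a 3-cycle.\<close>

definition rooted_subquiver :: "'v quiver \<Rightarrow> 'v \<Rightarrow> 'v \<Rightarrow> 'v \<Rightarrow> 'v quiver" where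
  "rooted_subquiver Q x y z =
     full_subquiver Q {w. \<exists>p. string_from_to Q x w p \<and> y \<notin> set p \<and> z \<notin> set p}"


section \<open>The labelling procedure for type \<open>A\<close>\<close>

definition label_input_A :: "'v quiver \<Rightarrow> 'v \<Rightarrow> 'v \<Rightarrow> bool" where
  "label_input_A Q e f \<longleftrightarrow>
     qverts Q \<noteq> {} \<and> mutation_type_A (card (qverts Q)) Q \<and> end_vertex Q e \<and> end_vertex Q f \<and>
     (card (qverts Q) \<ge> 2 \<longrightarrow> e \<noteq> f)"

text \<open>\<open>labelling_A Q e f L\<close>: the procedure applied to \<open>Q\<close> and the pair \<open>(e, f)\<close> can produce the
  labelling \<open>L\<close> of the vertices of \<open>Q\<close>. It is a relation because the end vertex \<open>z'\<close> is chosen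
  freely at each primary vertex of the string. Values of \<open>L\<close> outside \<open>Q\<close> are irrelevant.\<close>

inductive labelling_A :: "'v quiver \<Rightarrow> 'v \<Rightarrow> 'v \<Rightarrow> ('v \<Rightarrow> nat) \<Rightarrow> bool" where
  single:
  "label_input_A Q e f \<Longrightarrow> card (qverts Q) = 1 \<Longrightarrow> L e = 1 \<Longrightarrow> labelling_A Q e f L"
| along_string:
  "label_input_A Q e f \<Longrightarrow> card (qverts Q) \<ge> 2 \<Longrightarrow> string_from_to Q e f p \<Longrightarrow> L e = 1 \<Longrightarrow>
   (\<forall>i. i + 1 < length p \<longrightarrow> (\<nexists>z y. primary_along Q p (p ! i) z y) \<longrightarrow>
        L (p ! (i + 1)) = L (p ! i) + 1) \<Longrightarrow>
   (\<forall>i z y. i + 1 < length p \<longrightarrow> primary_along Q p (p ! i) z y \<longrightarrow>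
        (\<exists>z' L'. end_vertex (rooted_subquiver Q z (p ! i) y) z' \<and>
           (card (qverts (rooted_subquiver Q z (p ! i) y)) > 1 \<longrightarrow> z' \<noteq> z) \<and>
           labelling_A (rooted_subquiver Q z (p ! i) y) z' z L' \<and>
           (\<forall>w\<in>qverts (rooted_subquiver Q z (p ! i) y). L w = L (p ! i) + L' w)) \<and>
        L (p ! (i + 1)) = L (p ! i) + card (qverts (rooted_subquiver Q z (p ! i) y)) + 1) \<Longrightarrow>
   labelling_A Q e f L"


section \<open>Type II quivers and their labelling\<close>

definition double_triangle :: "'v \<Rightarrow> 'v \<Rightarrow> 'v \<Rightarrow> 'v \<Rightarrow> 'v quiver" where
  "double_triangle c1 c2 a b =
     \<lparr>qverts = {c1, c2, a, b},
      arrows = (\<lambda>x y. if (x, y) \<in> {(c1, a), (a, c2), (c1, b), (b, c2), (c2, c1)} then 1 else 0)\<rparr>"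

text \<open>\<open>\<Gamma>\<close> arises from the disjoint union of the double triangle, \<open>\<Gamma>1\<close> and \<open>\<Gamma>2\<close> by identifying
  \<open>c1\<close> with \<open>v1\<close> and \<open>c2\<close> with \<open>v2\<close>. The three pieces are taken as subquivers of \<open>\<Gamma>\<close>, so the
  identified vertices are equal and the pieces are otherwise disjoint.\<close>

definition type_II :: "nat \<Rightarrow> nat \<Rightarrow> 'v quiver \<Rightarrow> 'v quiver \<Rightarrow> 'v quiver \<Rightarrow>
    'v \<Rightarrow> 'v \<Rightarrow> 'v \<Rightarrow> 'v \<Rightarrow> bool" where
  "type_II n m \<Gamma> \<Gamma>1 \<Gamma>2 v1 v2 a b \<longleftrightarrow>
     1 \<le> m \<and> m \<le> n - 3 \<and>
     mutation_type_A m \<Gamma>1 \<and> mutation_type_A (n - m - 2) \<Gamma>2 \<and>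
     end_vertex \<Gamma>1 v1 \<and> end_vertex \<Gamma>2 v2 \<and>
     qverts \<Gamma>1 \<inter> qverts \<Gamma>2 = {} \<and> {a, b} \<inter> (qverts \<Gamma>1 \<union> qverts \<Gamma>2) = {} \<and> a \<noteq> b \<and>
     qverts \<Gamma> = qverts (double_triangle v1 v2 a b) \<union> qverts \<Gamma>1 \<union> qverts \<Gamma>2 \<and>
     (\<forall>x y. arrows \<Gamma> x y =
        arrows (double_triangle v1 v2 a b) x y + arrows \<Gamma>1 x y + arrows \<Gamma>2 x y)"

definition labelling_II :: "nat \<Rightarrow> nat \<Rightarrow> 'v quiver \<Rightarrow> 'v quiver \<Rightarrow>
    'v \<Rightarrow> 'v \<Rightarrow> 'v \<Rightarrow> 'v \<Rightarrow> ('v \<Rightarrow> nat) \<Rightarrow> bool" where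
  "labelling_II n m \<Gamma>1 \<Gamma>2 v1 v2 a b L \<longleftrightarrow>
     (\<exists>e L1. labelling_A \<Gamma>1 e v1 L1 \<and> (\<forall>x\<in>qverts \<Gamma>1. L x = L1 x)) \<and>
     (\<exists>f L2. labelling_A \<Gamma>2 v2 f L2 \<and> (\<forall>x\<in>qverts \<Gamma>2. L x = L2 x + m)) \<and>
     {L a, L b} = {n - 1, n}"

text \<open>In terms of labels: \<open>i\<close> is primary and \<open>j\<close> is its corresponding complementary vertex.\<close>

definition complementary :: "'v quiver \<Rightarrow> 'v quiver \<Rightarrow> ('v \<Rightarrow> nat) \<Rightarrow> nat \<Rightarrow> nat \<Rightarrow> bool" where
  "complementary \<Gamma>1 \<Gamma>2 L i j \<longleftrightarrow>
     (\<exists>x y z. (three_cycle \<Gamma>1 {x, y, z} \<or> three_cycle \<Gamma>2 {x, y, z}) \<and>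
              L x = i \<and> L y = j \<and> i < j \<and> j < L z)"


section \<open>Root systems and companion bases\<close>

definition root_reflection :: "'a::real_inner \<Rightarrow> 'a \<Rightarrow> 'a" where
  "root_reflection r v = v - (2 * (v \<bullet> r) / (r \<bullet> r)) *\<^sub>R r"

definition root_system :: "'a::euclidean_space set \<Rightarrow> bool" where
  "root_system \<Phi> \<longleftrightarrow>
     finite \<Phi> \<and> 0 \<notin> \<Phi> \<and> span \<Phi> = UNIV \<and>
     (\<forall>r\<in>\<Phi>. \<forall>c. c *\<^sub>R r \<in> \<Phi> \<longrightarrow> c = 1 \<or> c = -1) \<and>
     (\<forall>r\<in>\<Phi>. \<forall>s\<in>\<Phi>. root_reflection r s \<in> \<Phi>) \<and>
     (\<forall>r\<in>\<Phi>. \<forall>s\<in>\<Phi>. 2 * (s \<bullet> r) / (r \<bullet> r) \<in> \<int>)"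

definition simple_system :: "'a::euclidean_space set \<Rightarrow> 'a set \<Rightarrow> bool" where
  "simple_system \<Phi> S \<longleftrightarrow>
     S \<subseteq> \<Phi> \<and> independent S \<and>
     (\<forall>r\<in>\<Phi>. \<exists>c :: 'a \<Rightarrow> int. r = (\<Sum>s\<in>S. of_int (c s) *\<^sub>R s) \<and>
        ((\<forall>s\<in>S. c s \<ge> 0) \<or> (\<forall>s\<in>S. c s \<le> 0)))"

text \<open>\<open>\<Phi>\<close> is a root system, normalised so that roots have squared length 2, with simple roots
  \<open>\<alpha> 1, \<dots>, \<alpha> k\<close> whose Dynkin diagram is the simply-laced diagram with edge set \<open>E\<close>. For roots of
  squared length 2, the Cartan integers are the inner products.\<close>

definition simply_laced_system ::
    "nat \<Rightarrow> nat set set \<Rightarrow> 'a::euclidean_space set \<Rightarrow> (nat \<Rightarrow> 'a) \<Rightarrow> bool" where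
  "simply_laced_system k E \<Phi> \<alpha> \<longleftrightarrow>
     root_system \<Phi> \<and> (\<forall>r\<in>\<Phi>. r \<bullet> r = 2) \<and>
     inj_on \<alpha> {1..k} \<and> simple_system \<Phi> (\<alpha> ` {1..k}) \<and>
     (\<forall>i\<in>{1..k}. \<forall>j\<in>{1..k}. i \<noteq> j \<longrightarrow> \<alpha> i \<bullet> \<alpha> j = (if {i, j} \<in> E then -1 else 0))"

definition zscale :: "int \<Rightarrow> 'a::real_vector \<Rightarrow> 'a" where
  "zscale c v = of_int c *\<^sub>R v"

global_interpretation zmod: module zscale
  by unfold_locales (simp_all add: zscale_def algebra_simps)

definition root_lattice :: "'a::real_vector set \<Rightarrow> 'a set" where
  "root_lattice \<Phi> = zmod.span \<Phi>"

definition is_Z_basis :: "'a::real_vector set \<Rightarrow> 'a set \<Rightarrow> bool" where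
  "is_Z_basis M B \<longleftrightarrow> zmod.independent B \<and> zmod.span B = M"

text \<open>The basis is indexed by the vertices, hence the injectivity of \<open>\<gamma>\<close>.\<close>

definition companion_basis ::
    "nat \<Rightarrow> nat set set \<Rightarrow> 'a::euclidean_space set \<Rightarrow> 'v quiver \<Rightarrow> ('v \<Rightarrow> 'a) \<Rightarrow> bool" where
  "companion_basis k E \<Phi> \<Gamma> \<gamma> \<longleftrightarrow>
     mutation_type k E \<Gamma> \<and> (\<exists>\<alpha>. simply_laced_system k E \<Phi> \<alpha>) \<and>
     \<gamma> ` qverts \<Gamma> \<subseteq> \<Phi> \<and> inj_on \<gamma> (qverts \<Gamma>) \<and>
     is_Z_basis (root_lattice \<Phi>) (\<gamma> ` qverts \<Gamma>) \<and>
     (\<forall>x\<in>qverts \<Gamma>. \<forall>y\<in>qverts \<Gamma>. x \<noteq> y \<longrightarrow> \<bar>\<gamma> x \<bullet> \<gamma> y\<bar> = real (num_edges \<Gamma> x y))"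

definition beta :: "nat \<Rightarrow> nat \<Rightarrow> (nat \<Rightarrow> 'a::euclidean_space) \<Rightarrow> 'v quiver \<Rightarrow> 'v quiver \<Rightarrow>
    ('v \<Rightarrow> nat) \<Rightarrow> nat \<Rightarrow> 'a" where
  "beta n m \<alpha> \<Gamma>1 \<Gamma>2 L i =
     (if \<exists>j. complementary \<Gamma>1 \<Gamma>2 L i j
        then (\<Sum>t = i..(THE j. complementary \<Gamma>1 \<Gamma>2 L i j). \<alpha> t)
      else if i = n - 1 then (\<Sum>t = m + 1..n - 2. \<alpha> t) + \<alpha> (n - 1)
      else if i = n then (\<Sum>t = m + 1..n - 2. \<alpha> t) + \<alpha> n
      else \<alpha> i)"

end

(* A quiver of mutation type A is the line graph of a tree whose nodes have degree at most three
   (the dual tree of a triangulated polygon), each node of degree three carrying an oriented 3-cycle;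
   mutation moves the edges of the tree. In this picture a string is a path in the tree, and the
   labelling procedure numbers the nodes so that the vertex with label i is an edge from i to a
   larger node h: h = j + 1 if i is primary with complementary vertex j, and h = i + 1 otherwise.
   In the coordinates of type D this says that beta_i = e_i - e_h, so inner products of the beta_i
   count common nodes, i.e. arrows. The two glued pieces share the node m + 1, where
   beta_(n-1) and beta_n = e_(m+1) -/+ e_n are attached as well, and the shape of the roots lets
   one solve for the simple roots over the integers from the top node downwards. *)

theory Submission
  imports Defs
begin

section \<open>Type \<open>A\<close> quivers as line graphs of trees\<close>

text \<open>The tree has to be extracted from the mutation class, so its axioms must survive a flip.
  Mutation creates and cancels arrows according to orientation; the underlying graph alone is
  therefore not inductive, and the axioms also record that among three edges at a node each has at
  most one outgoing arrow. Acyclicity is stated as linear independence of the edges over the field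
  with two elements, witnessed by dual functions, because a flip is then a change of basis: an edge
  {s, w} hanging on x = {s, t} becomes {t, w}, the mod 2 sum of the two. The root system is abstract
  too, so the coordinates e_i are first constructed from the simple roots. When inner products are
  compared with arrows, the danger is that two contributions add up or cancel. Two edges of the tree
  share at most one node and avoid this; beta_(n-1) and beta_n share both e_(m+1) and e_n, and their
  cancellation is exactly what the missing arrow between a and b requires.\<close>

lemma num_edges_commute: "num_edges Q x y = num_edges Q y x"
  by (simp add: num_edges_def)

text \<open>\<open>Q\<close> is the line graph of a tree: the vertex \<open>x\<close> is the edge with ends \<open>E x\<close>. In a triangulated
  polygon, \<open>x\<close> is a diagonal and \<open>E x\<close> the two triangles beside it. Acyclicity is expressed by
  functions that are constant mod 2 along all edges but one.\<close>

locale tree_quiver =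
  fixes Q :: "'v quiver" and E :: "'v \<Rightarrow> nat set"
  assumes quiver: "is_quiver Q"
    and card_nodes: "x \<in> qverts Q \<Longrightarrow> card (E x) = 2"
    and num_edges_eq: "\<lbrakk>x \<in> qverts Q; y \<in> qverts Q; x \<noteq> y\<rbrakk>
      \<Longrightarrow> num_edges Q x y = (if E x \<inter> E y = {} then 0 else 1)"
    and one_out: "\<lbrakk>distinct [x, y, z]; {x, y, z} \<subseteq> qverts Q; u \<in> E x \<inter> E y \<inter> E z; arrows Q x y > 0\<rbrakk>
      \<Longrightarrow> arrows Q x z = 0"
    and cut_parity: "x \<in> qverts Q \<Longrightarrow> \<exists>\<phi>::nat \<Rightarrow> int. \<forall>y\<in>qverts Q. odd (sum \<phi> (E y)) \<longleftrightarrow> y = x"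
    and connected: "\<lbrakk>x \<in> qverts Q; y \<in> qverts Q\<rbrakk> \<Longrightarrow> (\<lambda>x y. 0 < num_edges Q x y)\<^sup>*\<^sup>* x y"
begin

lemma arrows_verts: "arrows Q x y > 0 \<Longrightarrow> x \<in> qverts Q \<and> y \<in> qverts Q"
  using quiver unfolding is_quiver_def by blast

lemma no_loop [simp]: "arrows Q x x = 0"
  using quiver unfolding is_quiver_def by blast

lemma no_2_cycle: "arrows Q x y > 0 \<Longrightarrow> arrows Q y x = 0"
  using quiver unfolding is_quiver_def by (metis neq0_conv)

lemma finite_verts: "finite (qverts Q)"
  using quiver unfolding is_quiver_def by blast

lemma adjacent_iff:
  "0 < num_edges Q x y \<longleftrightarrow> x \<in> qverts Q \<and> y \<in> qverts Q \<and> x \<noteq> y \<and> E x \<inter> E y \<noteq> {}"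
proof (cases "x \<in> qverts Q \<and> y \<in> qverts Q \<and> x \<noteq> y")
  case True
  then show ?thesis using num_edges_eq by auto
next
  case False
  then have "num_edges Q x y = 0"
    using arrows_verts[of x y] arrows_verts[of y x] no_loop[of x] unfolding num_edges_def by fastforce
  with False show ?thesis by auto
qed

lemma arrows_le_1: "arrows Q x y \<le> 1"
proof (cases "x \<in> qverts Q \<and> y \<in> qverts Q \<and> x \<noteq> y")
  case True
  then show ?thesis using num_edges_eq[of x y] by (simp add: num_edges_def split: if_splits)
next
  case False
  then show ?thesis using arrows_verts[of x y] no_loop[of x] by fastforce
qed

lemma arrow_share: "arrows Q x y > 0 \<Longrightarrow> E x \<inter> E y \<noteq> {}"
  using adjacent_iff[of x y] unfolding num_edges_def by auto

lemma adjacent_arrows: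
  assumes "x \<in> qverts Q" "y \<in> qverts Q" "x \<noteq> y" "E x \<inter> E y \<noteq> {}"
  shows "arrows Q x y = 1 \<and> arrows Q y x = 0 \<or> arrows Q x y = 0 \<and> arrows Q y x = 1"
  using num_edges_eq[OF assms(1-3)] assms(4) unfolding num_edges_def by auto

lemma adjacent_at_node:
  assumes "x \<in> qverts Q" "y \<in> qverts Q" "x \<noteq> y" "u \<in> E x" "u \<in> E y"
  shows "arrows Q x y = 1 \<and> arrows Q y x = 0 \<or> arrows Q x y = 0 \<and> arrows Q y x = 1"
  using adjacent_arrows[OF assms(1-3)] assms(4,5) by blast

text \<open>\<open>S\<close> collects the nodes whose parity under \<open>\<phi>\<close> differs
  from that of \<open>u\<close>. It is the side of the tree beyond \<open>x\<close> as seen from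
  \<open>u\<close>, since only \<open>x\<close> joins the two parity classes. Most tree arguments
  below use acyclicity in this form.\<close>

lemma cut:
  assumes "x \<in> qverts Q" "u \<in> E x"
  obtains S where "u \<notin> S" "E x - {u} \<subseteq> S" 
    "\<And>y. y \<in> qverts Q \<Longrightarrow> y \<noteq> x \<Longrightarrow> E y \<subseteq> S \<or> E y \<inter> S = {}"
proof -
  obtain \<phi> :: "nat \<Rightarrow> int" where \<phi>: "\<forall>y\<in>qverts Q. odd (sum \<phi> (E y)) \<longleftrightarrow> y = x"
    using cut_parity[OF assms(1)] by blast
  define S where "S = {w. odd (\<phi> w) \<noteq> odd (\<phi> u)}"
  have "E y \<subseteq> S \<or> E y \<inter> S = {}" if y: "y \<in> qverts Q" "y \<noteq> x" for y
  proof -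
    obtain a b where ab: "E y = {a, b}" "a \<noteq> b"
      using card_nodes[OF y(1)] by (metis card_2_iff)
    have "even (\<phi> a + \<phi> b)" using \<phi> y ab by auto
    then have "odd (\<phi> a) \<longleftrightarrow> odd (\<phi> b)" by simp
    then show ?thesis unfolding S_def ab by auto
  qed
  moreover have "E x - {u} \<subseteq> S"
  proof -
    obtain a b where ab: "E x = {a, b}" "a \<noteq> b"
      using card_nodes[OF assms(1)] by (metis card_2_iff)
    have "odd (\<phi> a + \<phi> b)" using \<phi> assms(1) ab by auto
    then have "odd (\<phi> a) \<longleftrightarrow> even (\<phi> b)" by auto
    then show ?thesis using assms(2) unfolding S_def ab by auto
  qed
  moreover have "u \<notin> S" unfolding S_def by simp
  ultimately show ?thesis using that by blast
qed

text \<open>A parity function that singles out \<open>x\<close> has the same sum on any edge with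
  the same ends, so the tree has no parallel edges.\<close>

lemma nodes_inj:
  assumes "x \<in> qverts Q" "y \<in> qverts Q" "E x = E y"
  shows "x = y"
  using cut_parity[OF assms(1)] assms by metis

lemma other_node:
  assumes "x \<in> qverts Q" "u \<in> E x"
  obtains v where "E x = {u, v}" "u \<noteq> v"
  using card_nodes[OF assms(1)] assms(2) by (metis card_2_iff insertE insert_commute singletonD)

lemma share_unique:
  assumes "x \<in> qverts Q" "y \<in> qverts Q" "x \<noteq> y" "u \<in> E x" "u \<in> E y" "v \<in> E x" "v \<in> E y"
  shows "u = v"
proof (rule ccontr)
  assume "u \<noteq> v"
  moreover obtain v' v'' where "E x = {u, v'}" "E y = {u, v''}"
    using other_node[OF assms(1,4)] other_node[OF assms(2,5)] by metis
  ultimately have "E x = E y" using assms(6,7) by auto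
  then show False using nodes_inj assms(1-3) by metis
qed

text \<open>The Helly property of subtrees. Cut at \<open>x\<close>, seen from the node
  \<open>u\<close> of \<open>x\<close> and \<open>y\<close>: a \<open>z\<close> avoiding
  \<open>u\<close> would meet \<open>y\<close> on the near side and \<open>x\<close> on the far
  side.\<close>

lemma common_node:
  assumes "{x, y, z} \<subseteq> qverts Q" "distinct [x, y, z]"
    and "E x \<inter> E y \<noteq> {}" "E y \<inter> E z \<noteq> {}" "E x \<inter> E z \<noteq> {}"
  obtains u where "u \<in> E x \<inter> E y \<inter> E z"
proof -
  obtain u where u: "u \<in> E x" "u \<in> E y" using assms by blast
  have "u \<in> E z"
  proof (rule ccontr)
    assume nu: "u \<notin> E z"
    obtain S where S: "u \<notin> S" "E x - {u} \<subseteq> S"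
      "\<And>y. y \<in> qverts Q \<Longrightarrow> y \<noteq> x \<Longrightarrow> E y \<subseteq> S \<or> E y \<inter> S = {}"
      using cut[of x u] assms u by auto
    have "E y \<inter> S = {}" using S(1) S(3)[of y] u assms by auto
    moreover have "E z \<inter> S = {} \<or> E z \<subseteq> S" using S(3)[of z] assms by auto
    ultimately have "E z \<inter> S = {}" using assms(4) by auto
    then show False using S(2) assms(5) nu by auto
  qed
  then show ?thesis using that u by blast
qed

text \<open>Three mutually adjacent vertices with at most one arrow leaving each can only be
  oriented around a cycle.\<close>

lemma at_node_cyclic:
  assumes "{x, y, z} \<subseteq> qverts Q" "distinct [x, y, z]" "u \<in> E x \<inter> E y \<inter> E z" "arrows Q x y > 0"
  shows "arrows Q y z > 0 \<and> arrows Q z x > 0"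
proof -
  have 1: "arrows Q x z = 0" using one_out[of x y z u] assms by auto
  then have zx: "arrows Q z x = 1" using adjacent_at_node[of x z u] assms by auto
  then have "arrows Q z y = 0" using one_out[of z x y u] assms by auto
  then show ?thesis using adjacent_at_node[of y z u] assms zx by auto
qed

lemma three_cycleD:
  assumes "three_cycle Q {x, y, z}"
  shows "{x, y, z} \<subseteq> qverts Q" "distinct [x, y, z]"
    "0 < num_edges Q x y" "0 < num_edges Q y z" "0 < num_edges Q x z"
    "\<exists>u. u \<in> E x \<inter> E y \<inter> E z"
proof -
  obtain a b c where abc: "{x, y, z} = {a, b, c}" "a \<noteq> b" "b \<noteq> c" "a \<noteq> c"
    "arrows Q a b > 0" "arrows Q b c > 0" "arrows Q c a > 0"
    using assms unfolding three_cycle_def by auto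
  have V: "{a, b, c} \<subseteq> qverts Q" using arrows_verts abc by blast
  then show v: "{x, y, z} \<subseteq> qverts Q" using abc by simp
  have "card {x, y, z} = 3" using abc by simp
  then show d: "distinct [x, y, z]" by (auto simp: card_insert_if split: if_splits)
  have "E a \<inter> E b \<noteq> {}" "E b \<inter> E c \<noteq> {}" "E a \<inter> E c \<noteq> {}"
    using arrow_share abc by blast+
  then obtain u where u: "u \<in> E a \<inter> E b \<inter> E c"
    using common_node[of a b c] V abc by auto
  then have "\<forall>w\<in>{a, b, c}. u \<in> E w" by auto
  then have u': "u \<in> E x \<inter> E y \<inter> E z" using abc(1) by auto
  then show "\<exists>u. u \<in> E x \<inter> E y \<inter> E z" by blast
  show "0 < num_edges Q x y" "0 < num_edges Q y z" "0 < num_edges Q x z"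
    unfolding adjacent_iff using v d u' by auto
qed

text \<open>This turns the condition on strings into a condition on the tree: two consecutive steps
  of a string never use the same node.\<close>

lemma three_cycle_iff_common_node:
  assumes "{x, y, z} \<subseteq> qverts Q" "distinct [x, y, z]"
  shows "three_cycle Q {x, y, z} \<longleftrightarrow> (\<exists>u. u \<in> E x \<inter> E y \<inter> E z)"
proof
  assume "\<exists>u. u \<in> E x \<inter> E y \<inter> E z"
  then obtain u where u: "u \<in> E x \<inter> E y \<inter> E z" by blast
  have "arrows Q x y > 0 \<or> arrows Q y x > 0"
    using adjacent_at_node[of x y u] assms u by auto
  then show "three_cycle Q {x, y, z}"
  proof
    assume "arrows Q x y > 0"
    then show ?thesis using at_node_cyclic[OF assms u] assms unfolding three_cycle_def by auto
  next
    assume a: "arrows Q y x > 0"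
    then have "arrows Q x z > 0 \<and> arrows Q z y > 0"
      using at_node_cyclic[of y x z u] assms u by auto
    moreover have "{x, y, z} = {y, x, z}" by auto
    ultimately show ?thesis using a assms unfolding three_cycle_def by (metis distinct_length_2_or_more)
  qed
qed (rule three_cycleD)

text \<open>Among four edges at a node, one would have two outgoing arrows there.\<close>

lemma at_most_three:
  assumes "distinct [x, y, z]" "{x, y, z, w} \<subseteq> qverts Q" "u \<in> E x" "u \<in> E y" "u \<in> E z" "u \<in> E w"
  shows "w \<in> {x, y, z}"
proof (rule ccontr)
  assume w: "w \<notin> {x, y, z}"
  \<comment> \<open>With \<open>x\<close> pointing to \<open>y\<close>, both \<open>z\<close> and
    \<open>w\<close> point to \<open>x\<close>; whichever of them also points to the other has two
    outgoing arrows at \<open>u\<close>.\<close>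
  have sym: False if "distinct [x, y, z, w]" "{x, y, z, w} \<subseteq> qverts Q"
    "u \<in> E x \<inter> E y \<inter> E z \<inter> E w" "arrows Q x y > 0" for x y z w
  proof -
    have "arrows Q z x > 0" using at_node_cyclic[of x y z u] that by auto
    moreover have "arrows Q y w > 0" "arrows Q w x > 0" using at_node_cyclic[of x y w u] that by auto
    moreover have "arrows Q z w > 0 \<or> arrows Q w z > 0" using adjacent_at_node[of z w u] that by auto
    ultimately show False using one_out[of z x w u] one_out[of w x z u] that by auto
  qed
  have "arrows Q x y > 0 \<or> arrows Q y x > 0" using adjacent_at_node[of x y u] assms by auto
  then show False using sym[of x y z w] sym[of y x z w] assms w by auto
qed

section \<open>Mutation as a flip of the tree\<close>

lemma swap_nodes:
  assumes "arrows Q x y > 0" "E x = {u, v}" "u \<noteq> v"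
  obtains s t w where "E x = {s, t}" "s \<noteq> t" "E y = {s, w}" "s \<noteq> w" "w \<noteq> t"
    "Transposition.transpose u v ` E y = {t, w}"
proof -
  have V: "x \<in> qverts Q" "y \<in> qverts Q" using arrows_verts assms(1) by auto
  have yx: "y \<noteq> x" using assms(1) by auto
  \<comment> \<open>\<open>s\<close> is the node where \<open>y\<close> hangs on \<open>x\<close>,
    and \<open>t\<close> is the other end of \<open>x\<close>. The flip slides \<open>y\<close>
    along \<open>x\<close> from \<open>s\<close> to \<open>t\<close> and keeps its far end
    \<open>w\<close>.\<close>
  obtain s t where st: "s \<in> E y" "{s, t} = {u, v}"
    using arrow_share[OF assms(1)] assms(2) by auto
  have st': "E x = {s, t}" "s \<noteq> t" using st assms by auto
  have "s = u \<and> t = v \<or> s = v \<and> t = u" using st(2) by (simp add: doubleton_eq_iff)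
  then have tr: "Transposition.transpose u v = Transposition.transpose s t"
    using transpose_commute by metis
  obtain w where w: "E y = {s, w}" "s \<noteq> w" using other_node[OF V(2) st(1)] .
  have wt: "w \<noteq> t" using w(1) st'(1) nodes_inj[OF V(2) V(1)] yx by auto
  have "Transposition.transpose u v ` E y = {t, w}"
    unfolding tr using w wt by (simp add: Transposition.transpose_def insert_commute)
  then show ?thesis using that st' w wt by blast
qed

text \<open>The model of \<open>mutate x Q\<close>: the flip at \<open>x\<close> swaps the ends of \<open>x\<close> in the edges that \<open>x\<close> points to.
  This is the outward mutation of companion bases.\<close>

lemma mutate_num_edges:
  assumes x: "x \<in> qverts Q" "E x = {u, v}" "u \<noteq> v"
    and F: "F = (\<lambda>y. if arrows Q x y > 0 then Transposition.transpose u v ` E y else E y)"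
    and yz: "y \<in> qverts Q" "z \<in> qverts Q" "y \<noteq> z"
  shows "num_edges (mutate x Q) y z = (if F y \<inter> F z = {} then 0 else 1)"
proof -
  have im: "Transposition.transpose u v ` A = A" if "u \<in> A \<longleftrightarrow> v \<in> A" for A :: "nat set"
    using that by (auto simp: Transposition.transpose_def image_iff)
  have imI: "Transposition.transpose u v ` A \<inter> Transposition.transpose u v ` B = {} \<longleftrightarrow> A \<inter> B = {}" for A B :: "nat set"
    by (metis image_Int image_is_empty inj_transpose)
  \<comment> \<open>The only configuration in which the flip can change an intersection:
    \<open>y\<close> moves and \<open>z\<close> stays. A \<open>z\<close> not adjacent to
    \<open>x\<close> is unaffected. A \<open>z\<close> at the end \<open>s\<close> forms a 3-cycle
    with \<open>x\<close> and \<open>y\<close>, and its arrow from \<open>y\<close> is cancelled. A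
    \<open>z\<close> at the other end \<open>t\<close> was not adjacent to \<open>y\<close> and
    gains an arrow.\<close>
  have outinter: "(Transposition.transpose u v ` E y \<inter> E z = {}) = (num_edges (mutate x Q) y z = 0)
      \<and> num_edges (mutate x Q) y z \<le> 1"
    if y: "y \<in> qverts Q" "z \<in> qverts Q" "y \<noteq> z" "z \<noteq> x" "arrows Q x y > 0" "arrows Q x z = 0" for y z
  proof -
    have yx: "y \<noteq> x" using that by auto
    have axy: "arrows Q x y = 1" "arrows Q y x = 0" using that arrows_le_1[of x y] no_2_cycle[of x y] by auto
    obtain s t w where st': "E x = {s, t}" "s \<noteq> t" and w: "E y = {s, w}" "s \<noteq> w" and wt: "w \<noteq> t"
      and Ey: "Transposition.transpose u v ` E y = {t, w}"
      using swap_nodes[OF y(5) x(2,3)] .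
    have st: "s \<in> E y" using w by simp
    show ?thesis
    proof (cases "arrows Q z x > 0")
      case False
      then have "E z \<inter> E x = {}" using adjacent_arrows[of z x] y x by fastforce
      then have "Transposition.transpose u v ` E y \<inter> E z = {} \<longleftrightarrow> E y \<inter> E z = {}" using Ey w st' by auto
      moreover have "num_edges (mutate x Q) y z = num_edges Q y z"
        using False axy that yx no_2_cycle[of y z] unfolding num_edges_def mutate_def
        by (cases "arrows Q y z = 0") simp_all
      ultimately show ?thesis using num_edges_eq[OF y(1-3)] by auto
    next
      case True
      then have azx: "arrows Q z x = 1" using arrows_le_1[of z x] by auto
      have ne: "num_edges (mutate x Q) y z =
          (arrows Q y z - (arrows Q z y + 1)) + (arrows Q z y + 1 - arrows Q y z)"
        using azx axy that yx unfolding num_edges_def mutate_def by simp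
      have ne': "num_edges (mutate x Q) y z = (if arrows Q y z > 0 then 0 else arrows Q z y + 1)"
        using ne arrows_le_1[of y z] no_2_cycle[of y z] by auto
      obtain r where r: "r \<in> E z" "r = s \<or> r = t" using arrow_share[OF True] st'(1) by blast
      show ?thesis
      proof (cases "s \<in> E z")
        case True
        then have "arrows Q y z > 0" using at_node_cyclic[of x y z s] x y yx st st' by auto
        moreover have "t \<notin> E z" using True share_unique[of x z s t] x y st' by auto
        moreover have "w \<notin> E z" using True share_unique[of y z s w] w y by auto
        ultimately show ?thesis using ne' Ey by auto
      next
        case False
        then have tz: "t \<in> E z" using r by auto
        have "E y \<inter> E z = {}"
        proof (rule ccontr)
          assume *: "E y \<inter> E z \<noteq> {}"
          have "E x \<inter> E z \<noteq> {}" "E x \<inter> E y \<noteq> {}" using tz st' st by auto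
          then obtain c where "c \<in> E x \<inter> E y \<inter> E z" using common_node[of x y z] * x y yx by auto
          then show False using False st' w wt by auto
        qed
        then have "arrows Q y z = 0" "arrows Q z y = 0"
          using arrow_share[of y z] arrow_share[of z y] by auto
        then show ?thesis using ne' Ey tz by auto
      qed
    qed
  qed
  have comm: "num_edges (mutate x Q) y z = num_edges (mutate x Q) z y" by (simp add: num_edges_def)
  have Fx: "F x = E x" unfolding F by simp
  \<comment> \<open>The swap exchanges the two ends of \<open>x\<close>, so it fixes
    \<open>E x\<close> and cannot change whether an edge meets \<open>x\<close>.\<close>
  have disj: "E x \<inter> F w = {} \<longleftrightarrow> E x \<inter> E w = {}" for w
  proof -
    have "Transposition.transpose u v ` E x = E x" using im[of "E x"] x(2) by simp
    then show ?thesis using imI[of "E x" "E w"] unfolding F by presburger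
  qed
  consider "y = x \<or> z = x" | "y \<noteq> x" "z \<noteq> x" "arrows Q x y > 0 \<longleftrightarrow> arrows Q x z > 0"
    | "y \<noteq> x" "z \<noteq> x" "arrows Q x y > 0" "arrows Q x z = 0"
    | "y \<noteq> x" "z \<noteq> x" "arrows Q x z > 0" "arrows Q x y = 0" by blast
  then show ?thesis
  proof cases
    case 1
    have "num_edges (mutate x Q) y z = num_edges Q y z"
      using 1 unfolding num_edges_def mutate_def by auto
    moreover have "F y \<inter> F z = {} \<longleftrightarrow> E y \<inter> E z = {}"
      using 1 Fx disj[of y] disj[of z] by (metis Int_commute)
    ultimately show ?thesis using num_edges_eq[OF yz] by auto
  next
    case 2
    have "num_edges (mutate x Q) y z = num_edges Q y z"
      using 2 no_2_cycle[of x y] no_2_cycle[of x z] no_2_cycle[of y z] unfolding num_edges_def mutate_def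
      by (cases "arrows Q y z = 0") auto
    moreover have "F y \<inter> F z = {} \<longleftrightarrow> E y \<inter> E z = {}"
      using 2 imI[of "E y" "E z"] unfolding F by simp
    ultimately show ?thesis using num_edges_eq[OF yz] by auto
  next
    case 3
    then show ?thesis using outinter[of y z] yz unfolding F by auto
  next
    case 4
    then show ?thesis using outinter[of z y] yz unfolding F comm by (auto simp: Int_commute)
  qed
qed


lemma tree_quiver_mutate:
  assumes x: "x \<in> qverts Q"
  shows "\<exists>F. tree_quiver (mutate x Q) F"
proof -
  obtain u v where uv: "E x = {u, v}" "u \<noteq> v" using card_nodes[OF x] by (metis card_2_iff)
  define \<tau> where "\<tau> = Transposition.transpose u v"
  define F where "F = (\<lambda>y. if arrows Q x y > 0 then \<tau> ` E y else E y)"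
  let ?M = "mutate x Q"
  have verts: "qverts ?M = qverts Q" by (simp add: mutate_def)
  have Fx: "F x = E x" unfolding F_def by simp
  have ne: "num_edges ?M y z = (if F y \<inter> F z = {} then 0 else 1)"
    if "y \<in> qverts Q" "z \<in> qverts Q" "y \<noteq> z" for y z
    using mutate_num_edges[OF x uv _ that] unfolding F_def \<tau>_def by simp
  have arrM: "arrows ?M x y = arrows Q y x" "arrows ?M y x = arrows Q x y" for y
    by (simp_all add: mutate_def)
  have arrM': "arrows ?M y z = (arrows Q y z + arrows Q y x * arrows Q x z)
      - (arrows Q z y + arrows Q z x * arrows Q x y)" if "y \<noteq> x" "z \<noteq> x" for y z
    using that by (simp add: mutate_def)
  have quiverM: "is_quiver ?M"
  proof -
    have "y \<in> qverts Q \<and> z \<in> qverts Q" if "arrows ?M y z \<noteq> 0" for y z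
    proof (cases "y = x \<or> z = x")
      case True
      then show ?thesis using that arrM arrows_verts by (metis neq0_conv)
    next
      case False
      then have "arrows Q y z > 0 \<or> (arrows Q y x > 0 \<and> arrows Q x z > 0)" using that arrM'[of y z]
        by (intro ccontr[of "_ \<or> _"]) auto
      then show ?thesis using arrows_verts by blast
    qed
    moreover have "arrows ?M y y = 0" for y using arrM arrM' no_loop by (cases "y = x") auto
    moreover have "arrows ?M y z = 0 \<or> arrows ?M z y = 0" for y z
    proof (cases "y = x \<or> z = x")
      case True
      then show ?thesis using arrM no_2_cycle by (metis neq0_conv)
    next
      case False
      then show ?thesis using arrM'[of y z] arrM'[of z y] by linarith
    qed
    ultimately show ?thesis unfolding is_quiver_def verts using finite_verts by blast
  qed
  have arrM_le: "arrows ?M y z = 1 \<and> arrows ?M z y = 0 \<or> arrows ?M y z = 0 \<and> arrows ?M z y = 1"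
    if "y \<in> qverts Q" "z \<in> qverts Q" "y \<noteq> z" "w \<in> F y" "w \<in> F z" for y z w
    using ne[OF that(1-3)] that(4,5) unfolding num_edges_def by (auto split: if_splits)
  \<comment> \<open>\<open>x\<close> as the source. Arrows at \<open>x\<close> are reversed, so
    \<open>b\<close> and \<open>c\<close> pointed to \<open>x\<close> before and have not moved; a
    3-cycle cannot have two arrows into \<open>x\<close>.\<close>
  have out_x: False if "distinct [x, b, c]" "{b, c} \<subseteq> qverts Q" "w \<in> F x \<inter> F b \<inter> F c"
    "arrows ?M x b > 0" "arrows ?M x c > 0" for b c w
  proof -
    have *: "arrows Q b x > 0" "arrows Q c x > 0" using that arrM by auto
    then have "F b = E b" "F c = E c" unfolding F_def using no_2_cycle by auto
    then have "w \<in> E b \<inter> E x \<inter> E c" using that Fx by auto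
    then show False using at_node_cyclic[of b x c w] * that x no_2_cycle[of c x] by auto
  qed
  \<comment> \<open>\<open>x\<close> as one of the targets, so \<open>a\<close> has been moved. If
    \<open>c\<close> was moved too, the common node pulls back along the swap to one of
    \<open>Q\<close>. If \<open>c\<close> pointed to \<open>x\<close>, the path from
    \<open>c\<close> to \<open>a\<close> through \<open>x\<close> cancels any arrow from
    \<open>a\<close> to \<open>c\<close>.\<close>
  have to_x: False if d: "distinct [a, x, c]" "{a, c} \<subseteq> qverts Q" and w: "w \<in> F a \<inter> F x \<inter> F c"
    and ax: "arrows ?M a x > 0" and ac: "arrows ?M a c > 0" for a c w
  proof -
    have xa: "arrows Q x a > 0" using ax arrM by auto
    have "E x \<inter> E c \<noteq> {}"
      using ne[of x c] num_edges_eq[of x c] w d x arrM unfolding num_edges_def by (auto split: if_splits)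
    then consider "arrows Q x c > 0" | "arrows Q c x > 0" using adjacent_arrows[of x c] d x by auto
    then show False
    proof cases
      case 1
      have "F a = \<tau> ` E a" "F c = \<tau> ` E c" "\<tau> ` E x = E x"
        using 1 xa uv unfolding F_def \<tau>_def by (auto simp: insert_commute)
      then have "w \<in> \<tau> ` E a \<inter> \<tau> ` E x \<inter> \<tau> ` E c" using w Fx by auto
      then have "w \<in> \<tau> ` (E a \<inter> E x \<inter> E c)" unfolding \<tau>_def by (simp add: image_Int)
      then obtain w' where "w' \<in> E x \<inter> E a \<inter> E c" by blast
      then have "arrows Q x c = 0" using one_out[of x a c w'] d x xa by auto
      then show False using 1 by simp
    next
      case 2
      have "arrows Q c x = 1" "arrows Q x a = 1" using 2 xa arrows_le_1[of c x] arrows_le_1[of x a] by auto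
      then have "arrows ?M a c = 0" using arrM'[of a c] d arrows_le_1[of a c] no_2_cycle[of x a] by auto
      then show False using ac by simp
    qed
  qed
  \<comment> \<open>\<open>x\<close> is none of the three. If their node is not an end of
    \<open>x\<close>, the edges at it are the old ones and the arrows leaving \<open>a\<close> there
    were already arrows of \<open>Q\<close>. Otherwise \<open>x\<close> is a fourth edge at the
    node, which the two previous cases exclude.\<close>
  have other: False if d: "distinct [a, b, c]" "x \<notin> {a, b, c}" "{a, b, c} \<subseteq> qverts Q"
    and w: "w \<in> F a \<inter> F b \<inter> F c" and ab: "arrows ?M a b > 0" and ac: "arrows ?M a c > 0" for a b c w
  proof (cases "w \<in> E x")
    case False
    then have "w \<in> F y \<longleftrightarrow> w \<in> E y" for y
      unfolding F_def \<tau>_def using uv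
      by (auto simp: transpose_image_eq Transposition.transpose_def image_iff)
    then have w': "w \<in> E a \<inter> E b \<inter> E c" using w by auto
    have old: "arrows Q a y > 0" if "y \<in> {b, c}" "arrows ?M a y > 0" for y
    proof (rule ccontr)
      assume "\<not> ?thesis"
      then have *: "arrows Q a y = 0" "arrows Q y a = 1" using adjacent_at_node[of a y w] w' that d by auto
      have "arrows Q a x * arrows Q x y \<le> 1" using arrows_le_1[of a x] arrows_le_1[of x y]
        by (metis mult_le_mono mult_1)
      then show False using * that(2) arrM'[of a y] that(1) d by auto
    qed
    have "arrows Q a b > 0" "arrows Q a c > 0" using old ab ac by auto
    then show False using one_out[of a b c w] d w' by auto
  next
    case True
    then have wx: "w \<in> F x" using Fx by simp
    have "\<not> arrows ?M a x > 0" using to_x[of a b w] w wx d ab by auto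
    then have xa: "arrows ?M x a > 0" using arrM_le[of a x w] w wx d x by auto
    have "\<not> arrows ?M x b > 0" "\<not> arrows ?M x c > 0" using out_x[of a b w] out_x[of a c w] xa w wx d by auto
    then have *: "arrows ?M b x > 0" "arrows ?M c x > 0"
      using arrM_le[of b x w] arrM_le[of c x w] w wx d x by auto
    have "arrows ?M b c > 0 \<or> arrows ?M c b > 0" using arrM_le[of b c w] w d by auto
    then show False using to_x[of b c w] to_x[of c b w] * w wx d by auto
  qed
  have one_outM: "arrows ?M a c = 0"
    if "distinct [a, b, c]" "{a, b, c} \<subseteq> qverts Q" "w \<in> F a \<inter> F b \<inter> F c" "arrows ?M a b > 0" for a b c w
  proof (rule ccontr)
    assume "arrows ?M a c \<noteq> 0"
    then have ac: "arrows ?M a c > 0" by simp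
    consider "a = x" | "b = x" | "c = x" | "x \<notin> {a, b, c}" by auto
    then show False
    proof cases
      case 1 then show ?thesis using out_x[of b c w] that ac by auto
    next
      case 2 then show ?thesis using to_x[of a c w] that ac by auto
    next
      case 3 then show ?thesis using to_x[of a b w] that ac by auto
    next
      case 4 then show ?thesis using other[of a b c w] that ac by auto
    qed
  qed
  have "card (F y) = 2" if "y \<in> qverts Q" for y
    using card_nodes[OF that] unfolding F_def \<tau>_def by (simp add: card_image)
  moreover have "\<exists>\<psi>::nat \<Rightarrow> int. \<forall>z\<in>qverts Q. odd (sum \<psi> (F z)) \<longleftrightarrow> z = y" if y: "y \<in> qverts Q" for y
  proof (cases "y = x")
    case False
    obtain \<phi> :: "nat \<Rightarrow> int" where \<phi>: "\<forall>z\<in>qverts Q. odd (sum \<phi> (E z)) \<longleftrightarrow> z = y"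
      using cut_parity[OF y] by blast
    \<comment> \<open>\<open>u\<close> and \<open>v\<close> have equal parity, so swapping them
      changes the parity of no edge and \<open>\<phi>\<close> still singles out
      \<open>y\<close>.\<close>
    have "even (\<phi> u + \<phi> v)" using \<phi> x False uv by auto
    then have "odd (\<phi> (\<tau> w)) \<longleftrightarrow> odd (\<phi> w)" for w
      unfolding \<tau>_def by (auto simp: Transposition.transpose_def)
    then have \<tau>_sum: "odd (\<phi> (\<tau> a) + \<phi> (\<tau> b)) \<longleftrightarrow> odd (\<phi> a + \<phi> b)" for a b
      by simp
    have "odd (sum \<phi> (F z)) \<longleftrightarrow> odd (sum \<phi> (E z))" if z: "z \<in> qverts Q" for z
    proof -
      obtain a b where ab: "E z = {a, b}" "a \<noteq> b" using card_nodes[OF z] by (metis card_2_iff)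
      then have "\<tau> a \<noteq> \<tau> b" unfolding \<tau>_def by (simp add: inj_eq)
      then show ?thesis using ab \<tau>_sum[of a b] unfolding F_def by simp
    qed
    then show ?thesis using \<phi> by blast
  next
    case True
    have "\<exists>\<Phi>. \<forall>z\<in>qverts Q. \<forall>y\<in>qverts Q. odd (sum (\<Phi> z :: nat \<Rightarrow> int) (E y)) \<longleftrightarrow> y = z"
      using cut_parity by (intro bchoice) blast
    then obtain \<Phi> :: "'v \<Rightarrow> nat \<Rightarrow> int"
      where \<Phi>: "\<And>z y. z \<in> qverts Q \<Longrightarrow> y \<in> qverts Q \<Longrightarrow> odd (sum (\<Phi> z) (E y)) \<longleftrightarrow> y = z" by blast
    define Out where "Out = {z. arrows Q x z > 0}"
    have Out: "Out \<subseteq> qverts Q" "finite Out" unfolding Out_def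
      using arrows_verts finite_verts by (auto intro: finite_subset)
    \<comment> \<open>Before the flip the function has to be odd on \<open>x\<close> and on
      everything that \<open>x\<close> points to: a moved edge \<open>{t, w}\<close> is the mod 2
      sum of \<open>{s, t}\<close> and \<open>{s, w}\<close>, so it becomes even.\<close>
    define \<psi> where "\<psi> w = \<Phi> x w + (\<Sum>z\<in>Out. \<Phi> z w)" for w
    have \<psi>: "odd (sum \<psi> (E z)) \<longleftrightarrow> (z = x) \<noteq> (z \<in> Out)" if z: "z \<in> qverts Q" for z
    proof -
      have "sum \<psi> (E z) = sum (\<Phi> x) (E z) + (\<Sum>z'\<in>Out. sum (\<Phi> z') (E z))"
        unfolding \<psi>_def by (simp add: sum.distrib) (rule sum.swap)
      moreover have "odd (\<Sum>z'\<in>Out. sum (\<Phi> z') (E z)) \<longleftrightarrow> z \<in> Out"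
      proof -
        have "{z' \<in> Out. odd (sum (\<Phi> z') (E z))} = (if z \<in> Out then {z} else {})"
          using \<Phi> z Out by auto
        then show ?thesis using Out by (simp add: even_sum_iff)
      qed
      ultimately show ?thesis using \<Phi>[OF x z] even_add by metis
    qed
    have "odd (sum \<psi> (F z)) \<longleftrightarrow> z = x" if z: "z \<in> qverts Q" for z
    proof (cases "z \<in> Out")
      case False
      then show ?thesis using \<psi>[OF z] unfolding F_def Out_def by simp
    next
      case True
      then have xz: "arrows Q x z > 0" unfolding Out_def by simp
      then have zx: "z \<noteq> x" by auto
      obtain s t w where *: "E x = {s, t}" "s \<noteq> t" "E z = {s, w}" "s \<noteq> w" "w \<noteq> t" "\<tau> ` E z = {t, w}"
        using swap_nodes[OF xz uv] unfolding \<tau>_def .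
      have "x \<notin> Out" unfolding Out_def by simp
      then have "odd (\<psi> s + \<psi> t)" using \<psi>[OF x] * by simp
      moreover have "odd (\<psi> s + \<psi> w)" using \<psi>[OF z] * True zx by simp
      ultimately have "even (\<psi> t + \<psi> w)" by (metis even_add)
      moreover have "F z = {t, w}" using * xz unfolding F_def by simp
      ultimately show ?thesis using * zx by simp
    qed
    then show ?thesis using True by blast
  qed
  moreover have "(\<lambda>y z. 0 < num_edges ?M y z)\<^sup>*\<^sup>* y z" if yz: "y \<in> qverts Q" "z \<in> qverts Q" for y z
  proof -
    let ?R = "\<lambda>y z. 0 < num_edges ?M y z"
    \<comment> \<open>An adjacency can only be lost by cancellation against a path through
      \<open>x\<close>, and then the detour over \<open>x\<close> survives.\<close>
    have step: "?R\<^sup>*\<^sup>* y z" if "0 < num_edges Q y z" for y z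
    proof (cases "0 < num_edges ?M y z")
      case False
      have "y \<noteq> x" "z \<noteq> x" using False that arrM unfolding num_edges_def by auto
      then have "arrows Q z x * arrows Q x y > 0 \<or> arrows Q y x * arrows Q x z > 0"
        using False that arrM'[of y z] arrM'[of z y] no_2_cycle[of y z]
        unfolding num_edges_def by linarith
      then have "num_edges Q x y > 0 \<and> num_edges Q x z > 0" unfolding num_edges_def by auto
      then have "?R y x" "?R x z" using arrM unfolding num_edges_def by auto
      then show ?thesis by (meson converse_rtranclp_into_rtranclp r_into_rtranclp)
    qed auto
    show ?thesis using connected[OF yz]
      by (induction rule: rtranclp_induct) (use step in \<open>auto intro: rtranclp_trans\<close>)
  qed
  ultimately have "tree_quiver ?M F"
    unfolding tree_quiver_def verts using quiverM ne one_outM by blast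
  then show ?thesis by blast
qed

end

section \<open>The linear quiver and the mutation class of type A\<close>

lemma dynkin_A_edge_iff:
  assumes "i \<in> {1..k}" "j \<in> {1..k}"
  shows "{i, j} \<in> dynkin_A k \<longleftrightarrow> j = i + 1 \<or> i = j + 1"
  using assms unfolding dynkin_A_def by (auto simp: doubleton_eq_iff)

lemma tree_quiver_dynkin_A:
  assumes quiver: "is_quiver Q" and graph: "has_underlying_graph k (dynkin_A k) Q"
  shows "\<exists>E. tree_quiver Q E"
proof -
  obtain f where f: "bij_betw f {1..k} (qverts Q)"
    and num: "\<And>i j. i \<in> {1..k} \<Longrightarrow> j \<in> {1..k} \<Longrightarrow>
      num_edges Q (f i) (f j) = (if j = i + 1 \<or> i = j + 1 then 1 else 0)"
    using graph dynkin_A_edge_iff unfolding has_underlying_graph_def by metis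
  define g where "g = inv_into {1..k} f"
  have g: "g x \<in> {1..k}" "f (g x) = x" if "x \<in> qverts Q" for x
    using f that inv_into_into[of x f "{1..k}"] f_inv_into_f[of x f "{1..k}"]
    unfolding g_def bij_betw_def by auto
  have g_inj: "g x = g y \<longleftrightarrow> x = y" if "x \<in> qverts Q" "y \<in> qverts Q" for x y
    using g that by metis
  have num': "num_edges Q x y = (if g y = g x + 1 \<or> g x = g y + 1 then 1 else 0)"
    if "x \<in> qverts Q" "y \<in> qverts Q" for x y
    using num[OF g(1)[OF that(1)] g(1)[OF that(2)]] g(2) that by simp
  have meet: "{i, i + 1} \<inter> {j, j + 1} = {} \<longleftrightarrow> \<not> (j = i + 1 \<or> i = j + 1)" if "i \<noteq> j" for i j :: nat
    using that by auto
  let ?R = "\<lambda>x y. 0 < num_edges Q x y"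
  have sym: "symp ?R" unfolding num_edges_def by (auto intro: sympI)
  have from1: "?R\<^sup>*\<^sup>* (f 1) (f i)" if "1 \<le> i" "i \<le> k" for i
    using that
  proof (induction i rule: dec_induct)
    case (step i)
    then have "?R (f i) (f (Suc i))" using num[of i "Suc i"] by simp
    then show ?case using step by (simp add: rtranclp.rtrancl_into_rtrancl)
  qed simp
  \<comment> \<open>Position \<open>i\<close> of the chain becomes the edge from node
    \<open>i\<close> to node \<open>i + 1\<close>. No node carries three edges, and the nodes up to
    \<open>g x\<close> form one side of the cut at \<open>x\<close>.\<close>
  have "tree_quiver Q (\<lambda>x. {g x, g x + 1})"
  proof
    show "is_quiver Q" by fact
    show "card {g x, g x + 1} = 2" for x by simp
    show "num_edges Q x y = (if {g x, g x + 1} \<inter> {g y, g y + 1} = {} then 0 else 1)"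
      if "x \<in> qverts Q" "y \<in> qverts Q" "x \<noteq> y" for x y
      using num'[OF that(1,2)] meet[of "g x" "g y"] g_inj that by simp
    show "arrows Q x z = 0" if "distinct [x, y, z]" "{x, y, z} \<subseteq> qverts Q"
      "w \<in> {g x, g x + 1} \<inter> {g y, g y + 1} \<inter> {g z, g z + 1}" for x y z w
    proof -
      have "g x \<noteq> g y" "g y \<noteq> g z" "g x \<noteq> g z" using g_inj that by auto
      then show ?thesis using that(3) by auto
    qed
    show "\<exists>\<phi>::nat \<Rightarrow> int. \<forall>y\<in>qverts Q. odd (sum \<phi> {g y, g y + 1}) \<longleftrightarrow> y = x"
      if "x \<in> qverts Q" for x
    proof (intro exI[of _ "\<lambda>w. if w \<le> g x then 1 else 0"] ballI)
      fix y assume y: "y \<in> qverts Q"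
      have "odd (sum (\<lambda>w. if w \<le> g x then 1 else 0 :: int) {g y, g y + 1}) \<longleftrightarrow> g y = g x" by auto
      then show "odd (sum (\<lambda>w. if w \<le> g x then 1 else 0 :: int) {g y, g y + 1}) \<longleftrightarrow> y = x"
        using g_inj[OF y that] by simp
    qed
    show "?R\<^sup>*\<^sup>* x y" if xy: "x \<in> qverts Q" "y \<in> qverts Q" for x y
    proof -
      have "?R\<^sup>*\<^sup>* (f 1) x" "?R\<^sup>*\<^sup>* (f 1) y" using from1[of "g x"] from1[of "g y"] g xy by auto
      then show ?thesis using sym symp_rtranclp by (metis (no_types, lifting) rtranclp_trans sympD)
    qed
  qed
  then show ?thesis by blast
qed

lemma mutation_type_A_tree_quiver:
  assumes "mutation_type_A k Q"
  shows "card (qverts Q) = k" "\<exists>E. tree_quiver Q E"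
proof -
  obtain Q0 where Q0: "is_quiver Q0" "has_underlying_graph k (dynkin_A k) Q0"
    and mut: "(\<lambda>P P'. \<exists>v\<in>qverts P. P' = mutate v P)\<^sup>*\<^sup>* Q0 Q"
    using assms unfolding mutation_type_def by blast
  have "card (qverts Q) = k \<and> (\<exists>E. tree_quiver Q E)" using mut
  proof (induction rule: rtranclp_induct)
    case base
    then show ?case using tree_quiver_dynkin_A[OF Q0] Q0(2) bij_betw_same_card
      unfolding has_underlying_graph_def by fastforce
  next
    case (step P P')
    then obtain v E where v: "v \<in> qverts P" "P' = mutate v P" and E: "tree_quiver P E" by blast
    have "qverts P' = qverts P" using v by (simp add: mutate_def)
    then show ?case using tree_quiver.tree_quiver_mutate[OF E v(1)] v step by simp
  qed
  then show "card (qverts Q) = k" "\<exists>E. tree_quiver Q E" by auto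
qed


section \<open>Strings and rooted subquivers\<close>

context tree_quiver begin

text \<open>A walk of minimal length admits no shortcut, so it neither turns back nor uses two sides
  of a 3-cycle, and it never returns to its start.\<close>

lemma ex_string:
  assumes "x \<in> qverts Q" "y \<in> qverts Q"
  obtains q where "string_from_to Q x y q" "\<And>i. 0 < i \<Longrightarrow> i < length q \<Longrightarrow> q ! i \<noteq> x"
proof -
  let ?R = "\<lambda>x y. 0 < num_edges Q x y"
  define walk where "walk q \<longleftrightarrow> q \<noteq> [] \<and> hd q = x \<and> last q = y \<and> successively ?R q" for q
  have "?R\<^sup>*\<^sup>* x y" using connected[OF assms] .
  then have "\<exists>q. q \<noteq> [] \<and> hd q = x \<and> last q = y \<and> successively ?R q"
  proof (induction rule: rtranclp_induct)
    case base
    then show ?case by (intro exI[of _ "[x]"]) auto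
  next
    case (step y z)
    then obtain q where "q \<noteq> [] \<and> hd q = x \<and> last q = y \<and> successively ?R q" by blast
    then show ?case using step(2)
      by (intro exI[of _ "q @ [z]"]) (auto simp: successively_append_iff)
  qed
  then obtain q where q: "walk q" and min: "\<And>q'. walk q' \<Longrightarrow> length q \<le> length q'"
    using ex_has_least_nat[of walk _ length] unfolding walk_def by blast
  have adj: "?R (q ! i) (q ! (i + 1))" if "i + 1 < length q" for i
    using q that successively_nth[of ?R q i] unfolding walk_def by simp
  have no_shortcut: "q ! i \<noteq> q ! (i + 2) \<and> \<not> ?R (q ! i) (q ! (i + 2))" if i: "i + 2 < length q" for i
  proof -
    define xs where "xs = take i q"
    define ys where "ys = drop (i + 3) q"
    have "drop j q = q ! j # drop (j + 1) q" if "j < length q" for j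
      using Cons_nth_drop_Suc[OF that] by simp
    from this[of i] this[of "i + 1"] this[of "i + 2"]
    have "drop i q = q ! i # q ! (i + 1) # q ! (i + 2) # ys"
      unfolding ys_def using i by (simp add: numeral_3_eq_3)
    then have split: "q = xs @ q ! i # q ! (i + 1) # q ! (i + 2) # ys"
      unfolding xs_def by (metis append_take_drop_id)
    have len: "length q = length xs + length ys + 3"
      unfolding xs_def ys_def using i by simp
    have w: "hd (xs @ q ! i # q ! (i + 1) # q ! (i + 2) # ys) = x"
      "last (xs @ q ! i # q ! (i + 1) # q ! (i + 2) # ys) = y"
      "successively ?R (xs @ q ! i # q ! (i + 1) # q ! (i + 2) # ys)"
      using q unfolding walk_def using split by metis+
    have "\<not> walk (xs @ q ! i # q ! (i + 2) # ys)" using min[of "xs @ q ! i # q ! (i + 2) # ys"] len by fastforce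
    then have "\<not> ?R (q ! i) (q ! (i + 2))"
      using w unfolding walk_def by (auto simp: successively_append_iff hd_append split: if_splits)
    moreover have "\<not> walk (xs @ q ! i # ys)" using min[of "xs @ q ! i # ys"] len by fastforce
    then have "q ! i \<noteq> q ! (i + 2)"
      using w unfolding walk_def by (auto simp: successively_append_iff hd_append split: if_splits)
    ultimately show ?thesis by blast
  qed
  have "set q \<subseteq> qverts Q"
  proof
    fix w assume "w \<in> set q"
    then obtain i where i: "i < length q" "q ! i = w" by (auto simp: in_set_conv_nth)
    show "w \<in> qverts Q"
    proof (cases i)
      case 0
      then show ?thesis using i q assms hd_conv_nth[of q] unfolding walk_def by auto
    next
      case (Suc j)
      then show ?thesis using i adj[of j] adjacent_iff by simp
    qed
  qed
  then have "string_from_to Q x y q"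
    unfolding string_from_to_def is_string_def using q adj no_shortcut three_cycleD(5)
    unfolding walk_def by blast
  moreover have "q ! i \<noteq> x" if "0 < i" "i < length q" for i
  proof
    assume "q ! i = x"
    then have "walk (drop i q)"
      using q that unfolding walk_def
      by (metis append_take_drop_id drop_eq_Nil hd_drop_conv_nth last_drop not_le successively_append_iff)
    then show False using min[of "drop i q"] that by simp
  qed
  ultimately show ?thesis using that by blast
qed

text \<open>The last claim is the one that matters: the rooted subquiver touches the rest of the
  quiver only through \<open>z\<close>, and only at \<open>x\<close> and \<open>y\<close>. In the
  tree it consists of \<open>z\<close> and the edges beyond it, as seen from the node of the
  3-cycle.\<close>

lemma rooted_subquiver_verts:
  assumes T: "three_cycle Q {x, y, z}"
  defines "R \<equiv> qverts (rooted_subquiver Q z x y)"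
  shows "R \<subseteq> qverts Q" "z \<in> R" "x \<notin> R" "y \<notin> R"
    and "\<And>w w'. \<lbrakk>w \<in> R; w' \<notin> R; 0 < num_edges Q w w'\<rbrakk> \<Longrightarrow> w = z \<and> w' \<in> {x, y}"
proof -
  note T' = three_cycleD[OF T]
  obtain u where u: "u \<in> E x" "u \<in> E y" "u \<in> E z" using T'(6) by blast
  obtain S where S: "u \<notin> S" "E z - {u} \<subseteq> S"
    "\<And>y. y \<in> qverts Q \<Longrightarrow> y \<noteq> z \<Longrightarrow> E y \<subseteq> S \<or> E y \<inter> S = {}"
    using cut[of z u] T'(1) u by auto
  define R' where "R' = {w \<in> qverts Q. E w \<inter> S \<noteq> {}}"
  have zR': "z \<in> R'"
  proof -
    obtain v where "E z = {u, v}" "u \<noteq> v" using other_node[of z u] u T'(1) by auto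
    then show ?thesis unfolding R'_def using S T'(1) by auto
  qed
  have xyR': "x \<notin> R'" "y \<notin> R'"
    unfolding R'_def using S(1) S(3)[of x] S(3)[of y] T'(1,2) u by auto
  have leave: "w = z \<and> w' \<in> {x, y}" if "w \<in> R'" "w' \<notin> R'" "0 < num_edges Q w w'" for w w'
  proof -
    have V: "w \<in> qverts Q" "w' \<in> qverts Q" "w \<noteq> w'" and meet: "E w \<inter> E w' \<noteq> {}"
      using that(3) unfolding adjacent_iff by auto
    have out: "E w' \<inter> S = {}" using that V unfolding R'_def by auto
    have wz: "w = z" using S(3)[of w] that(1) out meet V unfolding R'_def by blast
    then have "u \<in> E w'" using out meet S(2) by auto
    then have "w' \<in> {x, y, z}" using at_most_three[of x y z w' u] u T' V by auto
    then show ?thesis using wz V by auto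
  qed
  have eq: "R = R'"
  proof
    show "R \<subseteq> R'"
    proof
      fix w assume "w \<in> R"
      then obtain q where q: "string_from_to Q z w q" "x \<notin> set q" "y \<notin> set q"
        unfolding R_def rooted_subquiver_def full_subquiver_def by auto
      have "q ! i \<in> R'" if "i < length q" for i
        using that
      proof (induction i)
        case 0
        then show ?case using q zR' hd_conv_nth[of q] unfolding string_from_to_def is_string_def by auto
      next
        case (Suc i)
        then have "0 < num_edges Q (q ! i) (q ! Suc i)"
          using q(1) unfolding string_from_to_def is_string_def by simp
        then show ?case using leave[of "q ! i" "q ! Suc i"] Suc q nth_mem[of "Suc i" q]
            by (metis Suc_lessD insertE singletonD)
      qed
      then show "w \<in> R'" using q(1) unfolding string_from_to_def is_string_def
        by (metis diff_less last_conv_nth length_greater_0_conv zero_less_one)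
    qed
    show "R' \<subseteq> R"
    proof
      fix w assume w: "w \<in> R'"
      then obtain q where q: "string_from_to Q z w q" "\<And>i. 0 < i \<Longrightarrow> i < length q \<Longrightarrow> q ! i \<noteq> z"
        using ex_string[of z w] zR' unfolding R'_def by blast
      have len: "q \<noteq> []" "q ! (length q - 1) = w" 
        using q(1) unfolding string_from_to_def is_string_def by (auto simp: last_conv_nth)
      \<comment> \<open>Induction from the end: going backwards, \<open>R'\<close> can only be left
        at \<open>z\<close>, which the string does not visit again.\<close>
      have "q ! i \<in> R'" if "i \<le> length q - 1" for i
        using that
      proof (induction i rule: inc_induct)
        case base
        then show ?case using len w by simp
      next
        case (step i)
        then have "0 < num_edges Q (q ! Suc i) (q ! i)"
          using q(1) unfolding string_from_to_def is_string_def num_edges_def by (auto simp: add.commute)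
        then show ?case using leave[of "q ! Suc i" "q ! i"] step q(2)[of "Suc i"] by auto
      qed
      then have "set q \<subseteq> R'" using len(1) by (auto simp: in_set_conv_nth)
      then have "x \<notin> set q" "y \<notin> set q" using xyR' by auto
      then show "w \<in> R" using q(1) unfolding R_def rooted_subquiver_def full_subquiver_def by auto
    qed
  qed
  show "R \<subseteq> qverts Q" unfolding eq R'_def by blast
  show "z \<in> R" "x \<notin> R" "y \<notin> R" unfolding eq using zR' xyR' by auto
  show "w = z \<and> w' \<in> {x, y}" if "w \<in> R" "w' \<notin> R" "0 < num_edges Q w w'" for w w'
    using leave that unfolding eq by blast
qed

text \<open>An end vertex with two neighbours has valency exactly 2 and lies on a 3-cycle, whose
  other two vertices are then its only neighbours.\<close>

lemma end_vertex_neighbours: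
  assumes "end_vertex Q x" "0 < num_edges Q x y" "0 < num_edges Q x z" "y \<noteq> z"
  shows "three_cycle Q {x, y, z}"
proof -
  define N where "N = {y \<in> qverts Q. 0 < num_edges Q x y}"
  have "num_edges Q x y \<le> 1" if "y \<in> qverts Q" for y
    using num_edges_eq[of x y] that assms(1) unfolding end_vertex_def num_edges_def
    by (cases "x = y") (auto split: if_splits)
  then have "valency Q x = (\<Sum>y\<in>qverts Q. if 0 < num_edges Q x y then 1 else 0)"
    unfolding valency_def by (intro sum.cong refl) (force simp: le_Suc_eq)
  also have "\<dots> = card N" unfolding N_def using finite_verts by (simp add: sum.If_cases Int_def)
  finally have val: "valency Q x = card N" .
  have finN: "finite N" unfolding N_def using finite_verts by simp
  have yz: "{y, z} \<subseteq> N" unfolding N_def using assms adjacent_iff by auto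
  then have "card {y, z} \<le> card N" using finN card_mono by blast
  then have card2: "card N = 2" and "\<exists>T. three_cycle Q T \<and> x \<in> T"
    using assms(1,4) val unfolding end_vertex_def by auto
  then obtain a b c where abc: "three_cycle Q {a, b, c}" "x \<in> {a, b, c}"
    unfolding three_cycle_def by blast
  then obtain b c where bc: "three_cycle Q {x, b, c}" by (metis insertE insert_commute singletonD)
  then have "{b, c} \<subseteq> N" "b \<noteq> c" unfolding N_def using three_cycleD[OF bc] by auto
  then have "{b, c} = N" using card2 finN by (metis card_2_iff card_seteq order_refl)
  moreover have "{y, z} = N" using card2 finN yz assms(4) by (metis card_2_iff card_seteq order_refl)
  ultimately show ?thesis using bc by simp
qed

end

section \<open>Strings between two end vertices\<close>

locale string_in_tree_quiver = tree_quiver Q E for Q :: "'v quiver" and E +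
  fixes p :: "'v list"
  assumes string: "is_string Q p" and length_ge_2: "2 \<le> length p"
    and end_vertices: "end_vertex Q (hd p)" "end_vertex Q (last p)"
begin

lemma string_verts: "i < length p \<Longrightarrow> p ! i \<in> qverts Q"
  using string nth_mem unfolding is_string_def by blast

lemma string_step: "i + 1 < length p \<Longrightarrow> 0 < num_edges Q (p ! i) (p ! (i + 1))"
  using string unfolding is_string_def by blast

text \<open>Once the string has crossed the edge \<open>p ! (i + 1)\<close>, it stays on the far
  side. A later return to \<open>p ! (i + 1)\<close> itself must be excluded along the way; this
  comes from the induction hypothesis one step further on, whose cut separates the rest of the
  string from an end of \<open>p ! (i + 1)\<close>.\<close>

lemma string_beyond:
  assumes "i + 1 < length p" "u \<in> E (p ! i) \<inter> E (p ! (i + 1))"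
  shows "\<exists>S. u \<notin> S \<and> (\<forall>y\<in>qverts Q. y \<noteq> p ! (i + 1) \<longrightarrow> E y \<subseteq> S \<or> E y \<inter> S = {}) \<and>
    (\<forall>j>i + 1. j < length p \<longrightarrow> E (p ! j) \<subseteq> S)"
  using assms
proof (induction "length p - i" arbitrary: i u rule: less_induct)
  case less
  obtain S where S: "u \<notin> S" "E (p ! (i + 1)) - {u} \<subseteq> S"
    "\<And>y. y \<in> qverts Q \<Longrightarrow> y \<noteq> p ! (i + 1) \<Longrightarrow> E y \<subseteq> S \<or> E y \<inter> S = {}"
    using cut[of "p ! (i + 1)" u] less(3) string_verts[OF less(2)] by blast
  have "E (p ! j) \<subseteq> S" if "i + 1 < j" "j < length p" for j
  proof -
    have len: "i + 2 < length p" using that by simp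
    then have step: "0 < num_edges Q (p ! (i + 1)) (p ! (i + 2))" using string_step[of "i + 1"] by simp
    then obtain v where v: "v \<in> E (p ! (i + 1))" "v \<in> E (p ! (i + 2))" unfolding adjacent_iff by blast
    \<comment> \<open>A step through the same node as the previous one would put three consecutive
      vertices on a 3-cycle, which strings avoid.\<close>
    have uv: "u \<noteq> v"
    proof
      assume "u = v"
      moreover have "{p ! i, p ! (i + 1), p ! (i + 2)} \<subseteq> qverts Q" "distinct [p ! i, p ! (i + 1), p ! (i + 2)]"
        using string step string_step[OF less(2)] len unfolding adjacent_iff is_string_def by auto
      ultimately have "three_cycle Q {p ! i, p ! (i + 1), p ! (i + 2)}"
        using three_cycle_iff_common_node less(3) v by blast
      then show False using string len unfolding is_string_def by blast
    qed
    have "length p - (i + 1) < length p - i" "i + 1 + 1 < length p"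
      "v \<in> E (p ! (i + 1)) \<inter> E (p ! (i + 1 + 1))" using len v by auto
    from less(1)[OF this]
    obtain S' where S': "v \<notin> S'" "\<And>j. i + 2 < j \<Longrightarrow> j < length p \<Longrightarrow> E (p ! j) \<subseteq> S'"
      by auto
    have ne: "p ! k \<noteq> p ! (i + 1)" if "i + 1 < k" "k < length p" for k
    proof (cases "k = i + 2")
      case True
      then show ?thesis using step unfolding adjacent_iff by auto
    next
      case False
      then have "E (p ! k) \<subseteq> S'" using S'(2)[of k] that by simp
      then show ?thesis using S'(1) v(1) by auto
    qed
    have "i + 2 \<le> j" using that by simp
    then show ?thesis using that(2)
    proof (induction j rule: dec_induct)
      case base
      have "v \<in> S" using uv v(1) S(2) by auto
      then show ?case using S(3)[of "p ! (i + 2)"] string_verts[OF len] ne[of "i + 2"] v(2) len by auto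
    next
      case (step k)
      then have "E (p ! k) \<inter> E (p ! Suc k) \<noteq> {}" using string_step[of k] unfolding adjacent_iff by simp
      then show ?case using S(3)[of "p ! Suc k"] string_verts[of "Suc k"] ne[of "Suc k"] step by auto
    qed
  qed
  then show ?case
    by (intro exI[of _ S] conjI ballI allI impI) (use S(1,3) in \<open>blast+\<close>)
qed

lemma string_far:
  assumes "i + 1 < j" "j < length p"
  shows "E (p ! i) \<inter> E (p ! j) = {}"
proof -
  have step: "0 < num_edges Q (p ! i) (p ! (i + 1))" using string_step assms by simp
  then obtain u where u: "u \<in> E (p ! i) \<inter> E (p ! (i + 1))" unfolding adjacent_iff by blast
  obtain S where S: "u \<notin> S" "E (p ! j) \<subseteq> S"
    "\<And>y. y \<in> qverts Q \<Longrightarrow> y \<noteq> p ! (i + 1) \<Longrightarrow> E y \<subseteq> S \<or> E y \<inter> S = {}"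
    using string_beyond[of i u] u assms by auto
  then show ?thesis using S(3)[of "p ! i"] step u unfolding adjacent_iff by blast
qed

lemma string_adjacent:
  assumes "i < j" "j < length p"
  shows "p ! i \<noteq> p ! j" "0 < num_edges Q (p ! i) (p ! j) \<longleftrightarrow> j = i + 1"
proof -
  have far: "p ! i \<noteq> p ! j" "\<not> 0 < num_edges Q (p ! i) (p ! j)" if "j \<noteq> i + 1"
  proof -
    have "E (p ! i) \<inter> E (p ! j) = {}" using string_far[of i j] assms that by simp
    moreover have "card (E (p ! i)) = 2" using card_nodes string_verts assms by simp
    ultimately show "p ! i \<noteq> p ! j" "\<not> 0 < num_edges Q (p ! i) (p ! j)" unfolding adjacent_iff by auto
  qed
  show "p ! i \<noteq> p ! j" using far string_step[of i] assms unfolding adjacent_iff by (cases "j = i + 1") auto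
  show "0 < num_edges Q (p ! i) (p ! j) \<longleftrightarrow> j = i + 1"
    using far(2) string_step[of i] assms by (cases "j = i + 1") auto
qed

lemma nth_string_inj: "i < length p \<Longrightarrow> j < length p \<Longrightarrow> p ! i = p ! j \<longleftrightarrow> i = j"
  using string_adjacent(1) by (metis nat_neq_iff)

lemma primary_along_nth:
  assumes "i + 1 < length p"
  shows "primary_along Q p (p ! i) z y \<longleftrightarrow>
    y = p ! (i + 1) \<and> z \<notin> set p \<and> three_cycle Q {p ! i, p ! (i + 1), z}"
proof
  assume pr: "primary_along Q p (p ! i) z y"
  then obtain i' j where j: "i' < j" "j < length p" "p ! i' = p ! i" "p ! j = y"
    unfolding primary_along_def by blast
  then have "i' = i" using nth_string_inj assms by simp
  moreover have "0 < num_edges Q (p ! i) y"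
    using pr three_cycleD(3) unfolding primary_along_def by blast
  ultimately have "y = p ! (i + 1)" using string_adjacent(2)[of i j] j by simp
  then show "y = p ! (i + 1) \<and> z \<notin> set p \<and> three_cycle Q {p ! i, p ! (i + 1), z}"
    using pr unfolding primary_along_def by simp
next
  assume "y = p ! (i + 1) \<and> z \<notin> set p \<and> three_cycle Q {p ! i, p ! (i + 1), z}"
  then show "primary_along Q p (p ! i) z y"
    unfolding primary_along_def using assms by (metis less_add_one)
qed

text \<open>The 3-cycle sits at the only node shared by \<open>p ! i\<close> and
  \<open>p ! (i + 1)\<close>, and that node has room for just one further edge.\<close>

lemma complementary_unique:
  assumes "i + 1 < length p" "primary_along Q p (p ! i) z y" "primary_along Q p (p ! i) z' y'"
  shows "z = z'"
proof -
  let ?x = "p ! i" and ?y = "p ! (i + 1)"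
  have T: "three_cycle Q {?x, ?y, z}" "three_cycle Q {?x, ?y, z'}"
    using assms primary_along_nth by auto
  obtain u u' where u: "u \<in> E ?x \<inter> E ?y \<inter> E z" "u' \<in> E ?x \<inter> E ?y \<inter> E z'"
    using three_cycleD(6) T by meson
  have "u = u'" using share_unique[of ?x ?y u u'] u three_cycleD[OF T(1)] by auto
  then show ?thesis
    using at_most_three[of ?x ?y z z' u] u three_cycleD(1,2)[OF T(1)] three_cycleD(1,2)[OF T(2)] by auto
qed

text \<open>The string and its rooted subquivers together are closed under adjacency, hence
  everything by connectedness. A neighbour off the string completes a 3-cycle with some step of the
  string: at an inner vertex because both its nodes are shared with its neighbours on the string, at
  \<open>hd p\<close> and \<open>last p\<close> because these are end vertices.\<close>

lemma string_covers:
  assumes "w \<in> qverts Q"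
  shows "w \<in> set p \<or> (\<exists>i z y. i + 1 < length p \<and> primary_along Q p (p ! i) z y
    \<and> w \<in> qverts (rooted_subquiver Q z (p ! i) y))"
proof -
  define W where "W = set p \<union> {w. \<exists>i z y. i + 1 < length p \<and> primary_along Q p (p ! i) z y
    \<and> w \<in> qverts (rooted_subquiver Q z (p ! i) y)}"
  have p: "p \<noteq> []" using length_ge_2 by auto
  then have ends: "hd p = p ! 0" "last p = p ! (length p - 1)"
    by (simp_all add: hd_conv_nth last_conv_nth)
  have WI: "y \<in> W" if "i + 1 < length p" "three_cycle Q {p ! i, p ! (i + 1), y}" for i y
  proof (cases "y \<in> set p")
    case False
    then have "primary_along Q p (p ! i) y (p ! (i + 1))" using primary_along_nth that by simp
    then show ?thesis using rooted_subquiver_verts(2)[OF that(2)] that(1) unfolding W_def by blast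
  qed (simp add: W_def)
  have closed_p: "y \<in> W" if i: "i < length p" and adj: "0 < num_edges Q (p ! i) y" for i y
  proof (cases "y \<in> set p")
    case False
    then have ne: "y \<noteq> p ! j" if "j < length p" for j using that by auto
    consider "i = 0" | "i = length p - 1" | "0 < i" "i + 1 < length p" using i by linarith
    then show ?thesis
    proof cases
      case 1
      then have "three_cycle Q {p ! 0, p ! 1, y}"
        using end_vertex_neighbours[of "p ! 0" "p ! 1" y] end_vertices(1) ends adj ne[of 1]
          string_step[of 0] length_ge_2 by auto
      then show ?thesis using WI[of 0 y] length_ge_2 by simp
    next
      case 2
      define j where "j = length p - 2"
      have j: "i = j + 1" "j + 1 < length p" using 2 length_ge_2 unfolding j_def by auto
      have "0 < num_edges Q (p ! i) (p ! j)"
        using string_step[of j] j unfolding num_edges_def by (simp add: add.commute)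
      then have "three_cycle Q {p ! i, p ! j, y}"
        using end_vertex_neighbours[of "p ! i" "p ! j" y] end_vertices(2) ends(2) 2 adj ne[of j] j by auto
      then show ?thesis using WI[of j y] j by (simp add: insert_commute)
    next
      case 3
      then obtain j where j: "i = j + 1" by (metis Suc_eq_plus1 gr0_implies_Suc)
      let ?a = "p ! j" and ?b = "p ! (j + 1)" and ?c = "p ! (j + 2)"
      have s: "0 < num_edges Q ?a ?b" "0 < num_edges Q ?b ?c" "E ?a \<inter> E ?c = {}"
        using string_step[of j] string_step[of "j + 1"] string_far[of j "j + 2"] 3 j by auto
      obtain u v where uv: "u \<in> E ?a" "u \<in> E ?b" "v \<in> E ?b" "v \<in> E ?c"
        using s unfolding adjacent_iff by blast
      then have "u \<noteq> v" using s by auto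
      moreover have "?b \<in> qverts Q" using s(1) unfolding adjacent_iff by blast
      then obtain v' where "E ?b = {u, v'}" using other_node[OF _ uv(2)] by metis
      ultimately have Eb: "E ?b = {u, v}" using uv(3) by auto
      have V: "{?a, ?b, ?c, y} \<subseteq> qverts Q" and d: "distinct [?a, ?b, y]" "distinct [?b, ?c, y]"
        using s adj j ne[of j] ne[of "j + 1"] ne[of "j + 2"] 3 unfolding adjacent_iff by auto
      have "u \<in> E y \<or> v \<in> E y" using adj Eb j unfolding adjacent_iff by auto
      then have "three_cycle Q {?a, ?b, y} \<or> three_cycle Q {?b, ?c, y}"
        using three_cycle_iff_common_node[of ?a ?b y] three_cycle_iff_common_node[of ?b ?c y] V d uv by auto
      then show ?thesis using WI[of j y] WI[of "j + 1" y] 3 j by auto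
    qed
  qed (simp add: W_def)
  have closed: "y \<in> W" if x: "x \<in> W" and adj: "0 < num_edges Q x y" for x y
  proof (cases "x \<in> set p")
    case True
    then show ?thesis using closed_p adj by (metis in_set_conv_nth)
  next
    case False
    then obtain i z t where i: "i + 1 < length p" "primary_along Q p (p ! i) z t"
      "x \<in> qverts (rooted_subquiver Q z (p ! i) t)" using x unfolding W_def by blast
    then have T: "three_cycle Q {p ! i, t, z}" and t: "t = p ! (i + 1)" using primary_along_nth by auto
    show ?thesis
    proof (cases "y \<in> qverts (rooted_subquiver Q z (p ! i) t)")
      case True
      then show ?thesis using i unfolding W_def by blast
    next
      case False
      then have "y \<in> {p ! i, t}" using rooted_subquiver_verts(5)[OF T] i(3) adj by blast
      then show ?thesis using t i(1) unfolding W_def by auto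
    qed
  qed
  have "hd p \<in> qverts Q" using string_verts[of 0] ends p by simp
  then have "(\<lambda>x y. 0 < num_edges Q x y)\<^sup>*\<^sup>* (hd p) w" using connected assms by blast
  then have "w \<in> W" by (induction rule: rtranclp_induct) (use closed p in \<open>auto simp: W_def\<close>)
  then show ?thesis unfolding W_def by blast
qed

end


section \<open>The labelling of the tree\<close>

text \<open>The labels \<open>c + 1, \<dots>, c + k + 1\<close> become the nodes of the tree, the vertex \<open>x\<close> being its edge from
  \<open>L x\<close> to \<open>h x\<close>; so \<open>\<beta>\<close> of \<open>x\<close> will be \<open>\<epsilon> (L x) - \<epsilon> (h x)\<close>. The top node is a leaf, on the edge \<open>f\<close>.\<close>

definition tree_labelling :: "nat \<Rightarrow> 'v quiver \<Rightarrow> 'v \<Rightarrow> ('v \<Rightarrow> nat) \<Rightarrow> ('v \<Rightarrow> nat) \<Rightarrow> bool" where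
  "tree_labelling c Q f L h \<longleftrightarrow>
     f \<in> qverts Q \<and> bij_betw L (qverts Q) {c + 1..c + card (qverts Q)} \<and>
     L f = c + card (qverts Q) \<and> h f = c + card (qverts Q) + 1 \<and>
     (\<forall>x\<in>qverts Q. L x < h x \<and> (x \<noteq> f \<longrightarrow> h x \<le> c + card (qverts Q))) \<and>
     (\<forall>x\<in>qverts Q. \<forall>y\<in>qverts Q. x \<noteq> y \<longrightarrow>
        num_edges Q x y = (if {L x, h x} \<inter> {L y, h y} = {} then 0 else 1)) \<and>
     (\<forall>x y z. three_cycle Q {x, y, z} \<longrightarrow> L x < L y \<longrightarrow> L y < L z \<longrightarrow> h x = L y + 1) \<and>
     (\<forall>x\<in>qverts Q. h x \<noteq> L x + 1 \<longrightarrow> (\<exists>y z. three_cycle Q {x, y, z} \<and> L x < L y \<and> L y < L z))"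

lemma tree_labellingD:
  assumes "tree_labelling c Q f L h"
  shows "f \<in> qverts Q" "bij_betw L (qverts Q) {c + 1..c + card (qverts Q)}"
    "L f = c + card (qverts Q)" "h f = c + card (qverts Q) + 1"
    "\<And>x. x \<in> qverts Q \<Longrightarrow> L x < h x"
    "\<And>x. x \<in> qverts Q \<Longrightarrow> x \<noteq> f \<Longrightarrow> h x \<le> c + card (qverts Q)"
    "\<And>x y. x \<in> qverts Q \<Longrightarrow> y \<in> qverts Q \<Longrightarrow> x \<noteq> y \<Longrightarrow>
        num_edges Q x y = (if {L x, h x} \<inter> {L y, h y} = {} then 0 else 1)"
    "\<And>x y z. three_cycle Q {x, y, z} \<Longrightarrow> L x < L y \<Longrightarrow> L y < L z \<Longrightarrow> h x = L y + 1"
    "\<And>x. x \<in> qverts Q \<Longrightarrow> h x \<noteq> L x + 1 \<Longrightarrow>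
      \<exists>y z. three_cycle Q {x, y, z} \<and> L x < L y \<and> L y < L z"
  using assms unfolding tree_labelling_def by (elim conjE; simp)+

lemma tree_labelling_inj:
  "tree_labelling c Q f L h \<Longrightarrow> x \<in> qverts Q \<Longrightarrow> y \<in> qverts Q \<Longrightarrow> L x = L y \<longleftrightarrow> x = y"
  using tree_labellingD(2) by (metis bij_betw_imp_inj_on inj_on_eq_iff)

lemma tree_labelling_label:
  "tree_labelling c Q f L h \<Longrightarrow> x \<in> qverts Q \<Longrightarrow> L x \<in> {c + 1..c + card (qverts Q)}"
  using tree_labellingD(2) bij_betwE by metis

lemma tree_labelling_surj:
  "tree_labelling c Q f L h \<Longrightarrow> t \<in> {c + 1..c + card (qverts Q)} \<Longrightarrow> \<exists>x\<in>qverts Q. L x = t"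
  using tree_labellingD(2) by (metis bij_betw_imp_surj_on imageE)

lemma tree_labelling_shift:
  assumes tl: "tree_labelling c Q f L h" and quiver: "is_quiver Q"
    and L': "\<And>x. x \<in> qverts Q \<Longrightarrow> L' x = d + L x"
  shows "tree_labelling (d + c) Q f L' (\<lambda>x. d + h x)"
proof -
  note D = tree_labellingD[OF tl]
  let ?V = "qverts Q"
  have V: "x \<in> ?V \<and> y \<in> ?V \<and> z \<in> ?V" if "three_cycle Q {x, y, z}" for x y z
  proof -
    have "{x, y, z} \<subseteq> ?V"
      using that quiver unfolding three_cycle_def is_quiver_def by (metis insert_subset empty_subsetI neq0_conv)
    then show ?thesis by simp
  qed
  have "bij_betw (\<lambda>x. d + x) {c + 1..c + card ?V} {d + c + 1..d + c + card ?V}"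
    by (rule bij_betwI[of _ _ _ "\<lambda>x. x - d"]) auto
  from bij_betw_trans[OF D(2) this]
  have "bij_betw (\<lambda>x. d + L x) ?V {d + c + 1..d + c + card ?V}" by (simp add: comp_def)
  then have bij: "bij_betw L' ?V {d + c + 1..d + c + card ?V}"
    using bij_betw_cong[of ?V L' "\<lambda>x. d + L x"] L' by blast
  have "num_edges Q x y = (if {L' x, d + h x} \<inter> {L' y, d + h y} = {} then 0 else 1)"
    if "x \<in> ?V" "y \<in> ?V" "x \<noteq> y" for x y
    using D(7)[OF that] L' that by simp
  moreover have "d + h x = L' y + 1" if "three_cycle Q {x, y, z}" "L' x < L' y" "L' y < L' z" for x y z
    using D(8)[OF that(1)] that(2,3) L' V[OF that(1)] by simp
  moreover have "\<exists>y z. three_cycle Q {x, y, z} \<and> L' x < L' y \<and> L' y < L' z"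
    if x: "x \<in> ?V" "d + h x \<noteq> L' x + 1" for x
  proof -
    have "h x \<noteq> L x + 1" using that L' by simp
    then obtain y z where "three_cycle Q {x, y, z}" "L x < L y" "L y < L z" using D(9) x(1) by blast
    then show ?thesis using V[of x y z] L' by (intro exI[of _ y] exI[of _ z]) simp
  qed
  ultimately show ?thesis
    unfolding tree_labelling_def using D(1,3,4,5,6) L' bij by simp
qed

lemma three_cycle_full_subquiver:
  "three_cycle (full_subquiver Q S) T \<longleftrightarrow> three_cycle Q T \<and> T \<subseteq> S"
  unfolding three_cycle_def full_subquiver_def by (auto split: if_splits)

lemma num_edges_full_subquiver:
  "x \<in> S \<Longrightarrow> y \<in> S \<Longrightarrow> num_edges (full_subquiver Q S) x y = num_edges Q x y"
  unfolding num_edges_def full_subquiver_def by simp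

lemma qverts_full_subquiver [simp]: "qverts (full_subquiver Q S) = S"
  unfolding full_subquiver_def by simp

lemma rooted_subquiver_eq:
  "rooted_subquiver Q x y z = full_subquiver Q (qverts (rooted_subquiver Q x y z))"
  unfolding rooted_subquiver_def by simp

context string_in_tree_quiver
begin

text \<open>The string cuts the vertices into consecutive blocks of labels: a vertex of the string
  followed by the subquiver hanging off the 3-cycle through it and its successor.\<close>

lemma tree_labelling_along_string:
  fixes L :: "'v \<Rightarrow> nat"
  assumes start: "L (p ! 0) = 1"
    and plain: "\<And>i. i + 1 < length p \<Longrightarrow> \<nexists>z y. primary_along Q p (p ! i) z y \<Longrightarrow>
      L (p ! (i + 1)) = L (p ! i) + 1"
    and primary: "\<And>i z y. i + 1 < length p \<Longrightarrow> primary_along Q p (p ! i) z y \<Longrightarrow>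
      (\<exists>h. tree_labelling (L (p ! i)) (rooted_subquiver Q z (p ! i) y) z L h) \<and>
      L (p ! (i + 1)) = L (p ! i) + card (qverts (rooted_subquiver Q z (p ! i) y)) + 1"
  shows "\<exists>h. tree_labelling 0 Q (last p) L h"
proof -
  define prim where "prim i z \<longleftrightarrow> i + 1 < length p \<and> primary_along Q p (p ! i) z (p ! (i + 1))" for i z
  define RQ where "RQ i z = rooted_subquiver Q z (p ! i) (p ! (i + 1))" for i z
  define R where "R i = {w. \<exists>z. prim i z \<and> w \<in> qverts (RQ i z)}" for i
  \<comment> \<open>The first label after block \<open>i\<close>. It will also be the upper node of
    \<open>p ! i\<close> and of the complementary vertex, hence the node at which the next block is
    attached.\<close>
  define nxt where "nxt i = L (p ! i) + card (R i) + 1" for i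
  define B where "B i = insert (p ! i) (R i)" for i
  have prim_cycle: "three_cycle Q {p ! i, p ! (i + 1), z}" "z \<notin> set p" "i + 1 < length p"
    if "prim i z" for i z
    using that primary_along_nth unfolding prim_def by auto
  have R_eq: "R i = qverts (RQ i z)" if "prim i z" for i z
    using complementary_unique that unfolding R_def prim_def by blast
  have RQ_eq: "RQ i z = full_subquiver Q (R i)" if "prim i z" for i z
    unfolding R_eq[OF that] RQ_def by (rule rooted_subquiver_eq)
  \<comment> \<open>The complementary vertex and the upper nodes are chosen once for each block;
    where nothing hangs off the string their values are arbitrary.\<close>
  have "\<exists>z h. R i \<noteq> {} \<longrightarrow> prim i z \<and> tree_labelling (L (p ! i)) (RQ i z) z L h" for i
    using primary unfolding R_def RQ_def prim_def by blast
  then obtain zz H where zH: "\<And>i. R i \<noteq> {} \<Longrightarrow> prim i (zz i)"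
    and H: "\<And>i. R i \<noteq> {} \<Longrightarrow> tree_labelling (L (p ! i)) (RQ i (zz i)) (zz i) L (H i)"
    by metis
  note RD = tree_labellingD[OF H]
  have next_label: "L (p ! (i + 1)) = nxt i" if i: "i + 1 < length p" for i
  proof (cases "\<exists>z y. primary_along Q p (p ! i) z y")
    case True
    then obtain z y where z: "primary_along Q p (p ! i) z y" by blast
    then have y: "y = p ! (i + 1)" using primary_along_nth i by blast
    then have "prim i z" using z i unfolding prim_def by simp
    then show ?thesis using primary[OF i z] R_eq y unfolding nxt_def RQ_def by simp
  next
    case False
    then have "R i = {}" unfolding R_def prim_def by blast
    then show ?thesis using plain[OF i] False unfolding nxt_def by simp
  qed
  have R_verts: "R i \<subseteq> qverts Q" for i
    using rooted_subquiver_verts(1) prim_cycle unfolding R_def RQ_def by blast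
  have leave: "w = zz i \<and> w' \<in> {p ! i, p ! (i + 1)}"
    if "w \<in> R i" "w' \<notin> R i" "0 < num_edges Q w w'" for i w w'
    using rooted_subquiver_verts(5)[OF prim_cycle(1)[OF zH]] that R_eq[OF zH] unfolding RQ_def by blast
  have zz_adj: "0 < num_edges Q (p ! i) (zz i)" "0 < num_edges Q (zz i) (p ! (i + 1))" "zz i \<in> R i"
    if "R i \<noteq> {}" for i
    using three_cycleD[OF prim_cycle(1)[OF zH[OF that]]] RD(1)[OF that] R_eq[OF zH[OF that]]
    by (auto simp: num_edges_def)
  have R_bij: "bij_betw L (R i) {L (p ! i) + 1..L (p ! i) + card (R i)}" for i
    using RD(2)[of i] R_eq[OF zH, of i] by (cases "R i = {}") (simp_all add: bij_betw_def)
  have R_label: "L (p ! i) < L w \<and> L w < nxt i" if "w \<in> R i" for i w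
    using bij_betwE[OF R_bij[of i]] that unfolding nxt_def by fastforce
  \<comment> \<open>The root \<open>zz i\<close> is the leaf at the top node of its subquiver, and
    the offset \<open>L (p ! i)\<close> makes that node equal to \<open>nxt i\<close>.\<close>
  have R_H: "L w < H i w" "H i w \<le> nxt i" "H i w = nxt i \<longleftrightarrow> w = zz i" if "w \<in> R i" for i w
  proof -
    have ne: "R i \<noteq> {}" using that by auto
    have w: "w \<in> qverts (RQ i (zz i))" using that R_eq[OF zH[OF ne]] by simp
    show "L w < H i w" using RD(5)[OF ne w] .
    show "H i w \<le> nxt i" "H i w = nxt i \<longleftrightarrow> w = zz i"
      using RD(4)[OF ne] RD(6)[OF ne w] R_eq[OF zH[OF ne]] unfolding nxt_def
      by (cases "w = zz i"; simp)+
  qed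
  have B_label: "L (p ! i) \<le> L w" "L w < nxt i" "L w = L (p ! i) \<longleftrightarrow> w = p ! i" if "w \<in> B i" for i w
    using that R_label[of w i] unfolding B_def nxt_def by auto
  have mono: "nxt i \<le> L (p ! j)" if "i < j" "j < length p" for i j
  proof -
    have "i + 1 \<le> j" using that by simp
    then show ?thesis using that(2)
    proof (induction j rule: dec_induct)
      case (step k)
      then show ?case using next_label[of k] unfolding nxt_def[of k] by simp
    qed (use next_label[of i] in simp)
  qed
  have nxt_eq: "nxt i = L (p ! j) \<longleftrightarrow> j = i + 1" if ij: "i < j" "j < length p" for i j
  proof (cases "j = i + 1")
    case False
    then have "i + 1 < j" using ij by simp
    then have "L (p ! (i + 1)) < nxt (i + 1) \<and> nxt (i + 1) \<le> L (p ! j)"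
      using mono ij unfolding nxt_def by simp
    then show ?thesis using next_label[of i] ij False by simp
  qed (use next_label[of i] ij in simp)
  have B_unique: "i = j" if "w \<in> B i" "w \<in> B j" "i < length p" "j < length p" for i j w
    using B_label(1,2)[OF that(1)] B_label(1,2)[OF that(2)] mono[of i j] mono[of j i] that(3,4)
    by (cases i j rule: linorder_cases) auto
  have covered: "\<exists>i<length p. w \<in> B i" if w: "w \<in> qverts Q" for w
    using string_covers[OF w]
  proof
    assume "w \<in> set p"
    then show ?thesis unfolding B_def by (metis in_set_conv_nth insertI1)
  next
    assume "\<exists>i z y. i + 1 < length p \<and> primary_along Q p (p ! i) z y
      \<and> w \<in> qverts (rooted_subquiver Q z (p ! i) y)"
    then obtain i z y where *: "i + 1 < length p" "primary_along Q p (p ! i) z y"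
      "w \<in> qverts (rooted_subquiver Q z (p ! i) y)" by blast
    moreover from * have "y = p ! (i + 1)" using primary_along_nth by blast
    ultimately have "w \<in> R i" unfolding R_def RQ_def prim_def by blast
    then show ?thesis using *(1) unfolding B_def by (intro exI[of _ i]) simp
  qed
  have B_verts: "B i \<subseteq> qverts Q" if "i < length p" for i
    using R_verts string_verts[OF that] unfolding B_def by simp
  define r where "r = length p - 1"
  have "p \<noteq> []" using length_ge_2 by auto
  then have r: "r < length p" "last p = p ! r"
    using last_conv_nth[of p] unfolding r_def by auto
  have R_last: "R r = {}" unfolding R_def prim_def r_def by auto
  have bij_upto: "bij_betw L (\<Union>i\<le>n. B i) {1..<nxt n}" if "n < length p" for n
    using that
  proof (induction n)
    case 0
    have "bij_betw L ({p ! 0} \<union> R 0) ({1} \<union> {1 + 1..1 + card (R 0)})"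
      using R_bij[of 0] start by (intro bij_betw_combine) auto
    moreover have "{1} \<union> {1 + 1..1 + card (R 0)} = {1..<nxt 0}" unfolding nxt_def start by auto
    ultimately show ?case unfolding B_def by simp
  next
    case (Suc n)
    have eq: "L (p ! Suc n) = nxt n" using next_label[of n] Suc(2) by simp
    have "bij_betw L ({p ! Suc n} \<union> R (Suc n)) ({nxt n} \<union> {nxt n + 1..nxt n + card (R (Suc n))})"
      using R_bij[of "Suc n"] eq by (intro bij_betw_combine) auto
    moreover have "{nxt n} \<union> {nxt n + 1..nxt n + card (R (Suc n))} = {nxt n..<nxt (Suc n)}"
      unfolding nxt_def[of "Suc n"] eq by auto
    ultimately have "bij_betw L (B (Suc n)) {nxt n..<nxt (Suc n)}" unfolding B_def by simp
    then have "bij_betw L ((\<Union>i\<le>n. B i) \<union> B (Suc n)) ({1..<nxt n} \<union> {nxt n..<nxt (Suc n)})"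
      using Suc by (intro bij_betw_combine) auto
    moreover have "{1..<nxt n} \<union> {nxt n..<nxt (Suc n)} = {1..<nxt (Suc n)}"
      unfolding nxt_def[of "Suc n"] eq nxt_def[of n] by auto
    moreover have "(\<Union>i\<le>n. B i) \<union> B (Suc n) = (\<Union>i\<le>Suc n. B i)" by (auto simp: le_Suc_eq)
    ultimately show ?case by simp
  qed
  have union: "(\<Union>i\<le>r. B i) = qverts Q"
  proof
    show "(\<Union>i\<le>r. B i) \<subseteq> qverts Q" using B_verts r(1) by (intro UN_least) simp
    show "qverts Q \<subseteq> (\<Union>i\<le>r. B i)"
    proof
      fix w assume "w \<in> qverts Q"
      then obtain i where "i < length p" "w \<in> B i" using covered by blast
      moreover from this have "i \<le> r" unfolding r_def by simp
      ultimately show "w \<in> (\<Union>i\<le>r. B i)" by blast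
    qed
  qed
  have bij: "bij_betw L (qverts Q) {1..<nxt r}" using bij_upto[OF r(1)] union by simp
  then have card_eq: "card (qverts Q) + 1 = nxt r" using bij_betw_same_card[OF bij] unfolding nxt_def by simp
  then have bij': "bij_betw L (qverts Q) {0 + 1..0 + card (qverts Q)}"
    using bij by (metis add_0 Suc_eq_plus1 atLeastLessThanSuc_atLeastAtMost)
  have L_last: "L (last p) = card (qverts Q)" using card_eq R_last r unfolding nxt_def by simp
  have nxt_le: "nxt i \<le> card (qverts Q)" if "i < length p" "i \<noteq> r" for i
  proof -
    have "nxt i \<le> L (p ! r)" using mono[of i r] that r unfolding r_def by simp
    then show ?thesis using L_last r by simp
  qed
  define idx where "idx w = (THE i. i < length p \<and> w \<in> B i)" for w
  define h where "h w = (if w = p ! idx w then nxt (idx w) else H (idx w) w)" for w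
  have idx: "idx w = i" if "w \<in> B i" "i < length p" for w i
    unfolding idx_def using that B_unique by blast
  have h_string: "h (p ! i) = nxt i" if "i < length p" for i
    using idx[of "p ! i" i] that unfolding h_def B_def by simp
  have h_R: "h w = H i w" if "w \<in> R i" "i < length p" for w i
    using idx[of w i] that R_label[OF that(1)] unfolding h_def B_def by auto
  have h_bounds: "L w < h w" "h w \<le> nxt i" "h w = nxt i \<longleftrightarrow> w = p ! i \<or> (w \<in> R i \<and> w = zz i)"
    if "w \<in> B i" "i < length p" for w i
    using that h_string[of i] h_R[of w i] R_H[of w i] R_label[of w i] unfolding B_def nxt_def by auto
  have string_not_R: "p ! j \<notin> R i" if "i < length p" "j < length p" for i j
    using B_unique[of "p ! j" i j] R_label[of "p ! j" i] that unfolding B_def by auto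
  have adj_block: "0 < num_edges Q (p ! i) w \<longleftrightarrow> w = zz i" if "w \<in> R i" "i < length p" for w i
  proof
    assume "0 < num_edges Q (p ! i) w"
    then have "0 < num_edges Q w (p ! i)" by (simp add: num_edges_commute)
    then show "w = zz i" using leave[of w i "p ! i"] string_not_R that by blast
  qed (use zz_adj(1)[of i] that in blast)
  \<comment> \<open>Different blocks are joined only from one to the next, and only by edges from
    \<open>p ! i\<close> or \<open>zz i\<close> to the head of the next block.\<close>
  have adj_blocks: "0 < num_edges Q w w' \<longleftrightarrow> j = i + 1 \<and> w' = p ! j \<and> (w = p ! i \<or> (w \<in> R i \<and> w = zz i))"
    if w: "w \<in> B i" "w' \<in> B j" and ij: "i < j" "j < length p" for w w' i j
  proof -
    have sym: "0 < num_edges Q w w' \<longleftrightarrow> 0 < num_edges Q w' w" by (simp add: num_edges_commute)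
    have other: "w' \<notin> R i" "w \<notin> R j" using B_unique[of w' i j] B_unique[of w j i] w ij unfolding B_def by auto
    consider "w = p ! i" "w' = p ! j" | "w = p ! i" "w' \<in> R j" | "w \<in> R i" "w' = p ! j" | "w \<in> R i" "w' \<in> R j"
      using w unfolding B_def by auto
    then show ?thesis
    proof cases
      case 1
      then show ?thesis using string_adjacent(2)[OF ij] by simp
    next
      case 2
      then have "w' \<noteq> p ! j" using string_not_R[of j j] ij by auto
      moreover have "w \<in> {p ! j, p ! (j + 1)}" if "0 < num_edges Q w w'"
        using leave[OF 2(2) other(2) that[unfolded sym]] by blast
      moreover have "j + 1 < length p" using prim_cycle(3)[OF zH[of j]] 2 by auto
      ultimately show ?thesis using nth_string_inj[of i j] nth_string_inj[of i "j + 1"] ij 2 by auto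
    next
      case 3
      have ne: "w \<noteq> p ! i" using string_not_R[of i i] 3 ij by auto
      have i: "i + 1 < length p" using ij by simp
      have "w = zz i \<and> j = i + 1" if "0 < num_edges Q w w'"
        using leave[of w i w'] 3 other that nth_string_inj[of j i] nth_string_inj[of j "i + 1"] ij i by auto
      then show ?thesis using zz_adj(2)[of i] 3 ne by auto
    next
      case 4
      have i: "i + 1 < length p" using ij by simp
      have "\<not> 0 < num_edges Q w w'"
        using leave[of w i w'] 4 other string_not_R[of j i] string_not_R[of j "i + 1"] ij i by auto
      then show ?thesis using 4 string_not_R[of j j] ij by auto
    qed
  qed
  have meet_blocks: "{L w, h w} \<inter> {L w', h w'} \<noteq> {} \<longleftrightarrow> 0 < num_edges Q w w'"
    if w: "w \<in> B i" "w' \<in> B j" and ij: "i < j" "j < length p" for w w' i j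
  proof -
    have i: "i < length p" using ij by simp
    \<comment> \<open>The nodes of block \<open>i\<close> are at most \<open>nxt i\<close> and those
      of block \<open>j\<close> at least \<open>L (p ! j)\<close>, so \<open>nxt i\<close> is the
      only possible meeting point.\<close>
    have "L w < nxt i" "h w \<le> nxt i" "nxt i \<le> L (p ! j)" "L (p ! j) \<le> L w'" "L w' < h w'"
      using B_label[OF w(1)] B_label[OF w(2)] h_bounds[OF w(1) i] h_bounds[OF w(2) ij(2)] mono[OF ij] by auto
    then have "{L w, h w} \<inter> {L w', h w'} \<noteq> {} \<longleftrightarrow> h w = nxt i \<and> nxt i = L (p ! j) \<and> L w' = L (p ! j)"
      by auto
    then show ?thesis
      unfolding adj_blocks[OF that] nxt_eq[OF ij] B_label(3)[OF w(2)] h_bounds(3)[OF w(1) i] by blast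
  qed
  have meet_R: "{L w, h w} \<inter> {L w', h w'} \<noteq> {} \<longleftrightarrow> 0 < num_edges Q w w'"
    if w: "w \<in> R i" "w' \<in> R i" "w \<noteq> w'" and i: "i < length p" for w w' i
  proof -
    have ne: "R i \<noteq> {}" using w by auto
    have "num_edges (RQ i (zz i)) w w' = (if {L w, H i w} \<inter> {L w', H i w'} = {} then 0 else 1)"
      using RD(7)[OF ne, of w w'] w R_eq[OF zH[OF ne]] by simp
    moreover have "num_edges (RQ i (zz i)) w w' = num_edges Q w w'"
      unfolding RQ_eq[OF zH[OF ne]] using num_edges_full_subquiver w(1,2) by metis
    ultimately show ?thesis using h_R w i by auto
  qed
  have meet_head: "{L (p ! i), h (p ! i)} \<inter> {L w, h w} \<noteq> {} \<longleftrightarrow> 0 < num_edges Q (p ! i) w"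
    if w: "w \<in> R i" and i: "i < length p" for w i
    unfolding adj_block[OF that] h_string[OF i] h_R[OF that]
    using R_label[OF w] R_H[OF w] by auto
  have swap: "{L w, h w} \<inter> {L w', h w'} \<noteq> {} \<longleftrightarrow> 0 < num_edges Q w w'"
    if "{L w', h w'} \<inter> {L w, h w} \<noteq> {} \<longleftrightarrow> 0 < num_edges Q w' w" for w w'
    using that by (metis Int_commute num_edges_commute)
  have meet: "{L w, h w} \<inter> {L w', h w'} \<noteq> {} \<longleftrightarrow> 0 < num_edges Q w w'"
    if V: "w \<in> qverts Q" "w' \<in> qverts Q" "w \<noteq> w'" for w w'
  proof -
    obtain i j where w: "w \<in> B i" "w' \<in> B j" and len: "i < length p" "j < length p"
      using covered[OF V(1)] covered[OF V(2)] by blast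
    consider "i < j" | "j < i" | "i = j" "w = p ! i" | "i = j" "w' = p ! i" | "i = j" "w \<in> R i" "w' \<in> R i"
      using w unfolding B_def by fastforce
    then show ?thesis
    proof cases
      case 1
      then show ?thesis using meet_blocks[OF w] len by blast
    next
      case 2
      then show ?thesis using swap[OF meet_blocks[OF w(2,1)]] len by blast
    next
      case 3
      then have "w' \<in> R i" using w V unfolding B_def by auto
      then show ?thesis using meet_head[OF _ len(1)] 3(2) by metis
    next
      case 4
      then have "w \<in> R i" using w V unfolding B_def by auto
      then show ?thesis using swap[OF meet_head[OF _ len(1)]] 4(2) by metis
    next
      case 5
      then show ?thesis using meet_R[OF _ _ V(3) len(1)] by metis
    qed
  qed
  have num: "num_edges Q w w' = (if {L w, h w} \<inter> {L w', h w'} = {} then 0 else 1)"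
    if "w \<in> qverts Q" "w' \<in> qverts Q" "w \<noteq> w'" for w w'
    using meet[OF that] num_edges_eq[OF that] by (auto split: if_splits)
  \<comment> \<open>Blocks are ordered like their labels. A 3-cycle meeting two blocks consists of
    \<open>p ! i\<close>, \<open>zz i\<close> and \<open>p ! (i + 1)\<close>; the label of
    \<open>zz i\<close> is the last one before \<open>nxt i\<close>, whence the \<open>+ 1\<close>.
    Any other 3-cycle lies inside one rooted subquiver.\<close>
  have cyc: "h x = L y + 1" if T: "three_cycle Q {x, y, z}" and lt: "L x < L y" "L y < L z" for x y z
  proof -
    note T' = three_cycleD[OF T]
    obtain i j k where B: "x \<in> B i" "y \<in> B j" "z \<in> B k" and len: "i < length p" "j < length p" "k < length p"
      using covered[of x] covered[of y] covered[of z] T'(1) by auto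
    have "i \<le> j" "j \<le> k"
      using B_label[OF B(1)] B_label[OF B(2)] B_label[OF B(3)] mono[of j i] mono[of k j] len lt by linarith+
    then consider "i < j" | "i = j" "j < k" | "i = j" "j = k" by linarith
    then show ?thesis
    proof cases
      case 1
      have "i < k" using 1 \<open>j \<le> k\<close> by simp
      then have "y = p ! j" "z = p ! k" "j = i + 1" "k = i + 1"
        using adj_blocks[OF B(1,2) 1 len(2)] adj_blocks[OF B(1,3) _ len(3)] T' by auto
      then show ?thesis using T'(2) by simp
    next
      case 2
      then have "x = p ! i \<or> (x \<in> R i \<and> x = zz i)" "y = p ! i \<or> (y \<in> R i \<and> y = zz i)"
        using adj_blocks[OF B(1,3) _ len(3)] adj_blocks[OF B(2,3) _ len(3)] T' by auto
      moreover have "y \<noteq> p ! i" using B_label(1)[OF B(1)] lt by auto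
      ultimately have xy: "x = p ! i" "y \<in> R i" "y = zz i" using T'(2) by auto
      then have ne: "R i \<noteq> {}" by auto
      have "L y = L (p ! i) + card (R i)" using RD(3)[OF ne] R_eq[OF zH[OF ne]] xy by simp
      then show ?thesis using h_string[OF len(1)] xy unfolding nxt_def by simp
    next
      case 3
      have "y \<noteq> p ! i" "z \<noteq> p ! i" using B_label(1)[OF B(1)] lt by auto
      then have yz: "y \<in> R i" "z \<in> R i" using B 3 unfolding B_def by auto
      have "x \<noteq> p ! i"
        using adj_block[OF yz(1) len(1)] adj_block[OF yz(2) len(1)] T' by auto
      then have x: "x \<in> R i" using B(1) unfolding B_def by simp
      then have ne: "R i \<noteq> {}" by auto
      have "three_cycle (RQ i (zz i)) {x, y, z}"
        unfolding RQ_eq[OF zH[OF ne]] three_cycle_full_subquiver using T x yz by simp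
      from RD(8)[OF ne this lt] show ?thesis using h_R[OF x len(1)] by simp
    qed
  qed
  have cyc': "\<exists>y z. three_cycle Q {x, y, z} \<and> L x < L y \<and> L y < L z"
    if x: "x \<in> qverts Q" "h x \<noteq> L x + 1" for x
  proof -
    obtain i where i: "x \<in> B i" "i < length p" using covered x by blast
    show ?thesis
    proof (cases "x = p ! i")
      case True
      then have ne: "R i \<noteq> {}" using x(2) h_string[OF i(2)] unfolding nxt_def by auto
      note pr = prim_cycle[OF zH[OF ne]]
      have "L (p ! i) < L (zz i) \<and> L (zz i) < L (p ! (i + 1))"
        using R_label[OF zz_adj(3)[OF ne]] next_label[OF pr(3)] by simp
      moreover have "three_cycle Q {p ! i, zz i, p ! (i + 1)}" using pr(1) by (simp add: insert_commute)
      ultimately show ?thesis using True by blast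
    next
      case False
      then have xR: "x \<in> R i" using i(1) unfolding B_def by simp
      then have ne: "R i \<noteq> {}" by auto
      have "H i x \<noteq> L x + 1" using x(2) h_R[OF xR i(2)] by simp
      then obtain y z where "three_cycle (RQ i (zz i)) {x, y, z}" "L x < L y" "L y < L z"
        using RD(9)[OF ne, of x] xR R_eq[OF zH[OF ne]] by blast
      then show ?thesis unfolding RQ_eq[OF zH[OF ne]] three_cycle_full_subquiver by blast
    qed
  qed
  have h_le: "L x < h x \<and> (x \<noteq> last p \<longrightarrow> h x \<le> 0 + card (qverts Q))" if x: "x \<in> qverts Q" for x
  proof -
    obtain i where i: "x \<in> B i" "i < length p" using covered x by blast
    have "h x \<le> card (qverts Q)" if "x \<noteq> last p"
    proof -
      have "i \<noteq> r" using i that R_last r unfolding B_def by auto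
      then show ?thesis using h_bounds(2)[OF i] nxt_le[OF i(2)] by simp
    qed
    then show ?thesis using h_bounds(1)[OF i] by simp
  qed
  have "last p \<in> qverts Q" using string_verts[OF r(1)] r by simp
  moreover have "h (last p) = 0 + card (qverts Q) + 1" using h_string[OF r(1)] r card_eq by simp
  ultimately have "tree_labelling 0 Q (last p) L h"
    unfolding tree_labelling_def using bij' L_last h_le num cyc cyc' by simp
  then show ?thesis by blast
qed

end

lemma labelling_A_start: "labelling_A Q e f L \<Longrightarrow> L e = 1"
  by (induction rule: labelling_A.induct) auto

lemma labelling_A_input: "labelling_A Q e f L \<Longrightarrow> label_input_A Q e f"
  by (induction rule: labelling_A.induct) auto

text \<open>The free choice of \<open>z'\<close> in the recursion leaves no trace in the conclusion:
  only the root \<open>z\<close> takes part in the gluing, and it sits at the top because it is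
  second in the pair.\<close>

lemma labelling_A_tree_labelling:
  assumes "labelling_A Q e f L"
  shows "\<exists>h. tree_labelling 0 Q f L h"
  using assms
proof (induction rule: labelling_A.induct)
  case (single Q e f L)
  then obtain E where "tree_quiver Q E"
    using mutation_type_A_tree_quiver(2) unfolding label_input_A_def by blast
  then interpret tree_quiver Q E .
  have "qverts Q = {e}" "f = e" using single unfolding label_input_A_def end_vertex_def
    by (metis card_1_singletonE singletonD)+
  then have "tree_labelling 0 Q f L (\<lambda>_. 2)"
    using single three_cycleD(1,2) unfolding tree_labelling_def by (auto simp: bij_betw_def)
  then show ?case by blast
next
  case (along_string Q e f p L)
  note input = along_string(1) and card = along_string(2) and str = along_string(3)
    and start = along_string(4) and plain = along_string(5) and primary = along_string(6)
  obtain E where "tree_quiver Q E"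
    using input mutation_type_A_tree_quiver(2) unfolding label_input_A_def by blast
  then interpret tree_quiver Q E .
  have p: "is_string Q p" "hd p = e" "last p = f" using str unfolding string_from_to_def by auto
  have "e \<noteq> f" using input card unfolding label_input_A_def by simp
  then have "2 \<le> length p" using p unfolding is_string_def
    by (cases p rule: remdups_adj.cases) auto
  then interpret string_in_tree_quiver Q E p
    using p input unfolding label_input_A_def by unfold_locales auto
  have "p \<noteq> []" using p(1) unfolding is_string_def by simp
  then have "L (p ! 0) = 1" using start p by (simp add: hd_conv_nth)
  then have "\<exists>h. tree_labelling 0 Q (last p) L h"
  proof (rule tree_labelling_along_string)
    fix i assume "i + 1 < length p" "\<nexists>z y. primary_along Q p (p ! i) z y"
    then show "L (p ! (i + 1)) = L (p ! i) + 1" using plain by blast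
  next
    fix i z y assume i: "i + 1 < length p" "primary_along Q p (p ! i) z y"
    let ?R = "rooted_subquiver Q z (p ! i) y"
    obtain z' L' h where L': "labelling_A ?R z' z L'" "tree_labelling 0 ?R z L' h"
      "\<forall>w\<in>qverts ?R. L w = L (p ! i) + L' w"
      and nxt: "L (p ! (i + 1)) = L (p ! i) + card (qverts ?R) + 1"
      using primary i by blast
    have "mutation_type_A (card (qverts ?R)) ?R"
      using labelling_A_input[OF L'(1)] unfolding label_input_A_def by blast
    then obtain E' where "tree_quiver ?R E'" using mutation_type_A_tree_quiver(2) by blast
    then have "is_quiver ?R" unfolding tree_quiver_def by blast
    then have "tree_labelling (L (p ! i) + 0) ?R z L (\<lambda>x. L (p ! i) + h x)"
      using tree_labelling_shift[OF L'(2), of L "L (p ! i)"] L'(3) by blast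
    then show "(\<exists>h. tree_labelling (L (p ! i)) ?R z L h) \<and>
        L (p ! (i + 1)) = L (p ! i) + card (qverts ?R) + 1"
      using nxt by auto
  qed
  then show ?case using p by simp
qed


section \<open>Roots of type \<open>D\<close>\<close>

lemma dynkin_D_edge_iff:
  assumes "3 \<le> n" "1 \<le> i" "i < j" "j \<le> n"
  shows "{i, j} \<in> dynkin_D n \<longleftrightarrow> (j = i + 1 \<and> j < n) \<or> (i = n - 2 \<and> j = n)"
  using assms unfolding dynkin_D_def by (auto simp: doubleton_eq_iff)

lemma simply_laced_simple_root:
  assumes "simply_laced_system k D \<Phi> \<alpha>" "i \<in> {1..k}"
  shows "\<alpha> i \<in> \<Phi>"
proof -
  have "\<alpha> ` {1..k} \<subseteq> \<Phi>" using assms(1) unfolding simply_laced_system_def simple_system_def by blast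
  then show ?thesis using assms(2) by blast
qed

text \<open>The vectors come from solving the three formulas for \<open>\<epsilon>\<close> from the
  top downwards. The halves arise because the sum and the difference of the last two simple roots
  have to be twice \<open>\<epsilon> (n - 1)\<close> and twice \<open>\<epsilon> n\<close>.\<close>

lemma type_D_coordinates:
  fixes \<alpha> :: "nat \<Rightarrow> 'a::euclidean_space"
  assumes n: "3 \<le> n" and sys: "simply_laced_system n (dynkin_D n) \<Phi> \<alpha>"
  obtains \<epsilon> :: "nat \<Rightarrow> 'a" where
    "\<And>i j. i \<in> {1..n} \<Longrightarrow> j \<in> {1..n} \<Longrightarrow> \<epsilon> i \<bullet> \<epsilon> j = of_bool (i = j)"
    "\<And>t. 1 \<le> t \<Longrightarrow> t < n \<Longrightarrow> \<alpha> t = \<epsilon> t - \<epsilon> (t + 1)"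
    "\<alpha> n = \<epsilon> (n - 1) + \<epsilon> n"
proof -
  have sq: "\<alpha> i \<bullet> \<alpha> i = 2" if "i \<in> {1..n}" for i
    using simply_laced_simple_root[OF sys that] sys unfolding simply_laced_system_def by blast
  have ip: "\<alpha> i \<bullet> \<alpha> j = - of_bool ((j = i + 1 \<and> j < n) \<or> (i = n - 2 \<and> j = n))"
    if "1 \<le> i" "i < j" "j \<le> n" for i j
  proof -
    have "i \<in> {1..n}" "j \<in> {1..n}" "i \<noteq> j" using that by auto
    then have "\<alpha> i \<bullet> \<alpha> j = (if {i, j} \<in> dynkin_D n then - 1 else 0)"
      using sys unfolding simply_laced_system_def by blast
    then show ?thesis unfolding dynkin_D_edge_iff[OF n that] by simp
  qed
  define \<epsilon> where "\<epsilon> i = (if i = n then (1 / 2) *\<^sub>R (\<alpha> n - \<alpha> (n - 1))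
    else (\<Sum>t = i..n - 2. \<alpha> t) + (1 / 2) *\<^sub>R (\<alpha> n + \<alpha> (n - 1)))" for i
  have top: "\<epsilon> (n - 1) = (1 / 2) *\<^sub>R (\<alpha> n + \<alpha> (n - 1))" "\<epsilon> n = (1 / 2) *\<^sub>R (\<alpha> n - \<alpha> (n - 1))"
    using n unfolding \<epsilon>_def by auto
  have low: "\<epsilon> t = \<alpha> t + \<epsilon> (t + 1)" if "1 \<le> t" "t \<le> n - 2" for t
  proof -
    have "t \<noteq> n" "t + 1 \<noteq> n" using that n by auto
    then show ?thesis using that unfolding \<epsilon>_def by (simp add: sum.atLeast_Suc_atMost)
  qed
  have half: "(1 / 2) *\<^sub>R x + (1 / 2) *\<^sub>R x = x" for x :: 'a
    by (simp flip: scaleR_add_left)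
  have \<alpha>_n1: "\<alpha> (n - 1) = \<epsilon> (n - 1) - \<epsilon> n" and \<alpha>_n: "\<alpha> n = \<epsilon> (n - 1) + \<epsilon> n"
    unfolding top scaleR_add_right scaleR_diff_right using half[of "\<alpha> n"] half[of "\<alpha> (n - 1)"]
    by (simp_all add: algebra_simps)
  have top_ip: "\<alpha> (n - 1) \<bullet> \<alpha> n = 0" using ip[of "n - 1" n] n by auto
  \<comment> \<open>The products with the lower simple roots are carried along in the induction,
    because the next vector is \<open>\<alpha> t + \<epsilon> (t + 1)\<close>.\<close>
  have ortho: "(\<forall>j\<in>{i..n}. \<forall>k\<in>{i..n}. \<epsilon> j \<bullet> \<epsilon> k = of_bool (j = k)) \<and>
    (\<forall>t\<in>{1..<i}. \<forall>j\<in>{i..n}. \<epsilon> j \<bullet> \<alpha> t = - of_bool (j = t + 1))" if "i \<le> n - 1" "1 \<le> i" for i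
    using that
  proof (induction i rule: inc_induct)
    case base
    have "\<epsilon> (n - 1) \<bullet> \<epsilon> (n - 1) = 1" "\<epsilon> n \<bullet> \<epsilon> n = 1" "\<epsilon> (n - 1) \<bullet> \<epsilon> n = 0"
      using sq[of n] sq[of "n - 1"] top_ip n unfolding top
      by (auto simp: inner_add_left inner_add_right inner_diff_left inner_diff_right inner_commute)
    moreover have "{n - 1..n} = {n - 1, n}" using n by auto
    moreover have "\<epsilon> (n - 1) \<bullet> \<alpha> t = - of_bool (n - 1 = t + 1) \<and> \<epsilon> n \<bullet> \<alpha> t = 0"
      if "1 \<le> t" "t < n - 1" for t
    proof -
      have "\<alpha> t \<bullet> \<alpha> (n - 1) = - of_bool (n - 1 = t + 1)" "\<alpha> t \<bullet> \<alpha> n = - of_bool (n - 1 = t + 1)"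
        using ip[of t "n - 1"] ip[of t n] that by auto
      then show ?thesis unfolding top inner_commute[of _ "\<alpha> t"]
        by (simp add: inner_add_right inner_diff_right)
    qed
    ultimately show ?case using n by (auto simp: inner_commute)
  next
    case (step t)
    let ?s = "Suc t"
    have IH: "\<And>j k. j \<in> {?s..n} \<Longrightarrow> k \<in> {?s..n} \<Longrightarrow> \<epsilon> j \<bullet> \<epsilon> k = of_bool (j = k)"
      "\<And>j u. u \<in> {1..<?s} \<Longrightarrow> j \<in> {?s..n} \<Longrightarrow> \<epsilon> j \<bullet> \<alpha> u = - of_bool (j = u + 1)"
      using step by auto
    have t: "1 \<le> t" "t \<le> n - 2" "\<epsilon> t = \<alpha> t + \<epsilon> ?s" using step low[of t] by auto
    have new: "\<epsilon> t \<bullet> \<epsilon> k = 0" if "k \<in> {?s..n}" for k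
      using IH(1)[of ?s k] IH(2)[of t k] that t by (simp add: inner_add_left inner_commute[of "\<alpha> t"])
    have "\<epsilon> t \<bullet> \<epsilon> t = \<alpha> t \<bullet> \<alpha> t + 2 * (\<epsilon> ?s \<bullet> \<alpha> t) + \<epsilon> ?s \<bullet> \<epsilon> ?s"
      unfolding t(3) by (simp add: inner_add_left inner_add_right inner_commute)
    also have "\<dots> = 1" using sq[of t] IH(1)[of ?s ?s] IH(2)[of t ?s] t n by simp
    finally have self: "\<epsilon> t \<bullet> \<epsilon> t = 1" .
    have split: "{t..n} = insert t {?s..n}" using t n by auto
    have "\<epsilon> t \<bullet> \<alpha> u = - of_bool (t = u + 1)" if "u \<in> {1..<t}" for u
      using ip[of u t] IH(2)[of u ?s] that t n by (auto simp: inner_add_left inner_add_right inner_commute)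
    then show ?case using IH new self unfolding split by (auto simp: inner_commute)
  qed
  show ?thesis
  proof (rule that)
    show "\<epsilon> i \<bullet> \<epsilon> j = of_bool (i = j)" if "i \<in> {1..n}" "j \<in> {1..n}" for i j
      using ortho[of 1] that n by auto
    show "\<alpha> t = \<epsilon> t - \<epsilon> (t + 1)" if t: "1 \<le> t" "t < n" for t
    proof (cases "t = n - 1")
      case True
      then show ?thesis using \<alpha>_n1 n by simp
    next
      case False
      then show ?thesis using low[of t] t by simp
    qed
    show "\<alpha> n = \<epsilon> (n - 1) + \<epsilon> n" by (rule \<alpha>_n)
  qed
qed

section \<open>Reflections and integral bases\<close>

lemma reflection_root:
  assumes "root_system \<Phi>" "\<And>r. r \<in> \<Phi> \<Longrightarrow> r \<bullet> r = 2" "r \<in> \<Phi>" "s \<in> \<Phi>" "s \<bullet> r = - 1"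
  shows "s + r \<in> \<Phi>"
proof -
  have "root_reflection r s = s + r" using assms(2)[OF assms(3)] assms(5) unfolding root_reflection_def by simp
  then show ?thesis using assms(1,3,4) unfolding root_system_def by metis
qed

lemma zmod_independent_if_independent:
  fixes S :: "'a::real_vector set"
  assumes "independent S"
  shows "zmod.independent S"
proof
  assume "zmod.dependent S"
  then obtain T u v where T: "finite T" "T \<subseteq> S" "(\<Sum>v\<in>T. zscale (u v) v) = 0" "v \<in> T" "u v \<noteq> 0"
    unfolding zmod.dependent_explicit by blast
  then have "dependent S"
    unfolding dependent_explicit zscale_def
    by (intro exI[of _ T] exI[of _ "\<lambda>v. of_int (u v)"]) auto
  then show False using assms by simp
qed

lemma zmod_span_subset_span:
  fixes S :: "'a::real_vector set"
  shows "zmod.span S \<subseteq> span S"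
proof (rule zmod.span_minimal[OF span_superset])
  show "zmod.subspace (span S)"
    by (rule zmod.subspaceI) (auto simp: zscale_def span_zero span_add span_scale)
qed

text \<open>Independence comes for free: \<open>k\<close> is the dimension of the ambient space.\<close>

lemma Z_basis_if_generates:
  fixes \<alpha> :: "nat \<Rightarrow> 'a::euclidean_space"
  assumes sys: "simply_laced_system k D \<Phi> \<alpha>" and V: "finite V" "card V = k"
    and roots: "\<gamma> ` V \<subseteq> \<Phi>" and gen: "\<And>t. t \<in> {1..k} \<Longrightarrow> \<alpha> t \<in> zmod.span (\<gamma> ` V)"
  shows "inj_on \<gamma> V" "is_Z_basis (root_lattice \<Phi>) (\<gamma> ` V)"
proof -
  have simple: "simple_system \<Phi> (\<alpha> ` {1..k})" and inj: "inj_on \<alpha> {1..k}" and span: "span \<Phi> = UNIV"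
    using sys unfolding simply_laced_system_def root_system_def by auto
  have "r \<in> zmod.span (\<gamma> ` V)" if "r \<in> \<Phi>" for r
  proof -
    obtain c :: "'a \<Rightarrow> int" where r: "r = (\<Sum>s\<in>\<alpha> ` {1..k}. of_int (c s) *\<^sub>R s)"
      using simple \<open>r \<in> \<Phi>\<close> unfolding simple_system_def by blast
    show ?thesis unfolding r zscale_def[symmetric]
      by (intro zmod.span_sum zmod.span_scale) (use gen in auto)
  qed
  then have sub: "\<Phi> \<subseteq> zmod.span (\<gamma> ` V)" by blast
  have lattice: "zmod.span (\<gamma> ` V) = root_lattice \<Phi>"
    unfolding root_lattice_def
    using roots sub by (intro antisym zmod.span_mono zmod.span_minimal zmod.subspace_span)
  have "\<Phi> \<subseteq> span (\<gamma> ` V)" using sub zmod_span_subset_span by blast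
  then have "span \<Phi> \<subseteq> span (\<gamma> ` V)" by (rule span_minimal[OF _ subspace_span])
  then have UNIV: "UNIV \<subseteq> span (\<gamma> ` V)" using span by simp
  \<comment> \<open>The \<open>k\<close> simple roots are independent and at most \<open>k\<close>
    vectors \<open>\<gamma> x\<close> span the space, so all these numbers agree; equality gives
    injectivity and independence at once.\<close>
  have "k \<le> DIM('a)"
    using simple independent_bound[of "\<alpha> ` {1..k}"] card_image[OF inj] unfolding simple_system_def by simp
  moreover have "DIM('a) \<le> card (\<gamma> ` V)"
    using span_card_ge_dim[of "\<gamma> ` V" UNIV] UNIV V by simp
  moreover have "card (\<gamma> ` V) \<le> k" using card_image_le V by blast
  ultimately have card: "card (\<gamma> ` V) = card V" "card (\<gamma> ` V) = DIM('a)" using V by auto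
  show "inj_on \<gamma> V" using eq_card_imp_inj_on V(1) card(1) .
  have "independent (\<gamma> ` V)"
    using card_le_dim_spanning[of "\<gamma> ` V" UNIV] UNIV V(1) card(2) by simp
  then show "is_Z_basis (root_lattice \<Phi>) (\<gamma> ` V)"
    unfolding is_Z_basis_def using zmod_independent_if_independent lattice by blast
qed

section \<open>Gluing the two trees and checking the companion basis\<close>

theorem theorem4p3:
  fixes n m :: nat
    and \<Gamma> \<Gamma>1 \<Gamma>2 :: "'v quiver"
    and v1 v2 a b :: 'v
    and L :: "'v \<Rightarrow> nat"
    and \<Phi> :: "'a::euclidean_space set"
    and \<alpha> :: "nat \<Rightarrow> 'a"
  assumes "4 \<le> n"
    and "type_II n m \<Gamma> \<Gamma>1 \<Gamma>2 v1 v2 a b"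
    and "mutation_type_D n \<Gamma>"
    and "labelling_II n m \<Gamma>1 \<Gamma>2 v1 v2 a b L"
    and "simply_laced_system n (dynkin_D n) \<Phi> \<alpha>"
  shows "companion_basis n (dynkin_D n) \<Phi> \<Gamma> (\<lambda>x. beta n m \<alpha> \<Gamma>1 \<Gamma>2 L (L x))"
proof -
  note sys = assms(5)
  have n: "4 \<le> n" by fact
  have m: "1 \<le> m" "m \<le> n - 3"
    and mut: "mutation_type_A m \<Gamma>1" "mutation_type_A (n - m - 2) \<Gamma>2"
    and ends: "v1 \<in> qverts \<Gamma>1" "v2 \<in> qverts \<Gamma>2"
    and disj: "qverts \<Gamma>1 \<inter> qverts \<Gamma>2 = {}" "{a, b} \<inter> (qverts \<Gamma>1 \<union> qverts \<Gamma>2) = {}" "a \<noteq> b"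
    and verts: "qverts \<Gamma> = {a, b} \<union> qverts \<Gamma>1 \<union> qverts \<Gamma>2"
    and arr: "\<And>x y. arrows \<Gamma> x y = arrows (double_triangle v1 v2 a b) x y + arrows \<Gamma>1 x y + arrows \<Gamma>2 x y"
    using assms(2) unfolding type_II_def end_vertex_def double_triangle_def by auto
  have m2: "m + (n - m - 2) = n - 2" "m + 1 \<le> n - 2" using m n by auto
  obtain E1 E2 where "tree_quiver \<Gamma>1 E1" "tree_quiver \<Gamma>2 E2"
    using mutation_type_A_tree_quiver(2) mut by meson
  interpret T1: tree_quiver \<Gamma>1 E1 by fact
  interpret T2: tree_quiver \<Gamma>2 E2 by fact
  have card: "card (qverts \<Gamma>1) = m" "card (qverts \<Gamma>2) = n - m - 2"
    using mutation_type_A_tree_quiver(1) mut by blast+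
  obtain e L1 f L2 where lab: "labelling_A \<Gamma>1 e v1 L1" "\<forall>x\<in>qverts \<Gamma>1. L x = L1 x"
      "labelling_A \<Gamma>2 v2 f L2" "\<forall>x\<in>qverts \<Gamma>2. L x = L2 x + m" and Lab: "{L a, L b} = {n - 1, n}"
    using assms(4) unfolding labelling_II_def by blast
  obtain h1 h2 where "tree_labelling 0 \<Gamma>1 v1 L1 h1" "tree_labelling 0 \<Gamma>2 f L2 h2"
    using labelling_A_tree_labelling lab by meson
  \<comment> \<open>Shift 0 merely replaces \<open>L1\<close> by \<open>L\<close> on
    \<open>\<Gamma>1\<close>; shift \<open>m\<close> places the nodes of \<open>\<Gamma>2\<close> at
    m + 1, ..., n - 1.\<close>
  from tree_labelling_shift[OF this(1) T1.quiver, of L 0] tree_labelling_shift[OF this(2) T2.quiver, of L m]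
  obtain h1 h2 where tl1: "tree_labelling 0 \<Gamma>1 v1 L h1" and tl2: "tree_labelling m \<Gamma>2 f L h2"
    using lab(2,4) by auto
  note D1 = tree_labellingD[OF tl1, unfolded card add_0] and D2 = tree_labellingD[OF tl2, unfolded card m2]
  have Lv2: "L v2 = m + 1" using labelling_A_start[OF lab(3)] lab(4) ends by auto
  define h where "h x = (if x \<in> qverts \<Gamma>1 then h1 x else h2 x)" for x
  define W where "W = qverts \<Gamma>1 \<union> qverts \<Gamma>2"
  \<comment> \<open>As second vertex of its pair, \<open>v1\<close> is the leaf at the top node
    \<open>m + 1\<close> of the first tree; as first vertex of its pair, \<open>v2\<close> has the
    lowest label \<open>m + 1\<close> in the second.\<close>
  have L1: "1 \<le> L x" "L x \<le> m" "L x < h x" "h x \<le> m + 1" "h x = m + 1 \<longleftrightarrow> x = v1" if "x \<in> qverts \<Gamma>1" for x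
    using tree_labelling_label[OF tl1 that] D1(4) D1(5)[OF that] D1(6)[OF that] that
    unfolding h_def card by (cases "x = v1"; simp)+
  have L2: "m + 1 \<le> L x" "L x \<le> n - 2" "L x < h x" "h x \<le> n - 1" "L x = m + 1 \<longleftrightarrow> x = v2"
    if x: "x \<in> qverts \<Gamma>2" for x
  proof -
    have h: "h x = h2 x" using that disj unfolding h_def by auto
    show "m + 1 \<le> L x" "L x \<le> n - 2" using tree_labelling_label[OF tl2 x] unfolding card m2 by auto
    show "L x < h x" using D2(5)[OF x] h by simp
    show "h x \<le> n - 1" using D2(4) D2(6)[OF x] h n by (cases "x = f") auto
    show "L x = m + 1 \<longleftrightarrow> x = v2" using tree_labelling_inj[OF tl2 x ends(2)] Lv2 by simp
  qed
  have LW: "1 \<le> L x" "L x \<le> n - 2" "L x < h x" "h x \<le> n - 1" if "x \<in> W" for x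
    using that L1[of x] L2[of x] m n unfolding W_def by auto
  have surj: "\<exists>x\<in>W. L x = t" if "1 \<le> t" "t \<le> n - 2" for t
    using tree_labelling_surj[OF tl1, of t] tree_labelling_surj[OF tl2, of t] that
    unfolding W_def card m2 by (cases "t \<le> m") auto
  obtain \<epsilon> :: "nat \<Rightarrow> 'a" where ortho: "\<And>i j. i \<in> {1..n} \<Longrightarrow> j \<in> {1..n} \<Longrightarrow> \<epsilon> i \<bullet> \<epsilon> j = of_bool (i = j)"
    and \<alpha>: "\<And>t. 1 \<le> t \<Longrightarrow> t < n \<Longrightarrow> \<alpha> t = \<epsilon> t - \<epsilon> (t + 1)" and \<alpha>_n: "\<alpha> n = \<epsilon> (n - 1) + \<epsilon> n"
    using type_D_coordinates[of n \<Phi> \<alpha>] n sys by auto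
  have telescope: "(\<Sum>t = i..j. \<alpha> t) = \<epsilon> i - \<epsilon> (j + 1)" if "1 \<le> i" "i \<le> j" "j < n" for i j
    using that(2,3)
  proof (induction j rule: dec_induct)
    case base
    then show ?case using \<alpha> that(1) by simp
  next
    case (step j)
    then show ?case using \<alpha>[of "Suc j"] that(1) by simp
  qed
  let ?\<beta> = "\<lambda>x. beta n m \<alpha> \<Gamma>1 \<Gamma>2 L (L x)"
  \<comment> \<open>\<open>complementary\<close> speaks of labels only, so its 3-cycle could lie in
    either piece. The label ranges, up to \<open>m\<close> and from \<open>m + 1\<close> on, force
    it into the piece containing \<open>x\<close>.\<close>
  have compl: "h x = j + 1" if x: "x \<in> W" and c: "complementary \<Gamma>1 \<Gamma>2 L (L x) j" for x j
  proof -
    obtain x' y z where xyz: "three_cycle \<Gamma>1 {x', y, z} \<or> three_cycle \<Gamma>2 {x', y, z}"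
      "L x' = L x" "L y = j" "L x' < L y" "L y < L z"
      using c unfolding complementary_def by metis
    from xyz(1) show ?thesis
    proof
      assume T: "three_cycle \<Gamma>1 {x', y, z}"
      then have x': "x' \<in> qverts \<Gamma>1" using T1.three_cycleD(1) by blast
      then have "x \<in> qverts \<Gamma>1" using x L1(2)[of x'] L2(1)[of x] xyz(2) unfolding W_def by auto
      then have "x' = x" using tree_labelling_inj[OF tl1 x'] xyz(2) by blast
      then show ?thesis using D1(8)[OF T xyz(4,5)] xyz(3) x' unfolding h_def by simp
    next
      assume T: "three_cycle \<Gamma>2 {x', y, z}"
      then have x': "x' \<in> qverts \<Gamma>2" using T2.three_cycleD(1) by blast
      then have "x \<in> qverts \<Gamma>2" using x L2(1)[of x'] L1(2)[of x] xyz(2) unfolding W_def by auto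
      then have "x' = x" using tree_labelling_inj[OF tl2 x'] xyz(2) by blast
      then show ?thesis using D2(8)[OF T xyz(4,5)] xyz(3) x' disj unfolding h_def by auto
    qed
  qed
  have no_compl: "h x = L x + 1" if x: "x \<in> W" and nc: "\<nexists>j. complementary \<Gamma>1 \<Gamma>2 L (L x) j" for x
  proof (rule ccontr)
    assume "h x \<noteq> L x + 1"
    then have "\<exists>y z. (three_cycle \<Gamma>1 {x, y, z} \<or> three_cycle \<Gamma>2 {x, y, z}) \<and> L x < L y \<and> L y < L z"
      using D1(9)[of x] D2(9)[of x] x unfolding W_def h_def by (auto split: if_splits)
    then show False using nc unfolding complementary_def by blast
  qed
  have \<beta>_W: "?\<beta> x = \<epsilon> (L x) - \<epsilon> (h x)" if x: "x \<in> W" for x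
  proof (cases "\<exists>j. complementary \<Gamma>1 \<Gamma>2 L (L x) j")
    case True
    then obtain j where j: "complementary \<Gamma>1 \<Gamma>2 L (L x) j" by blast
    have hj: "h x = j + 1" using compl[OF x j] .
    have "(THE j. complementary \<Gamma>1 \<Gamma>2 L (L x) j) = j"
    proof (rule the_equality)
      show "complementary \<Gamma>1 \<Gamma>2 L (L x) j" by (rule j)
      show "j' = j" if "complementary \<Gamma>1 \<Gamma>2 L (L x) j'" for j' using compl[OF x that] hj by simp
    qed
    then show ?thesis using True telescope[of "L x" j] LW[OF x] hj n unfolding beta_def by simp
  next
    case False
    then show ?thesis using no_compl[OF x False] LW[OF x] \<alpha>[of "L x"] n unfolding beta_def by auto
  qed
  \<comment> \<open>\<open>beta\<close> asks for a complementary vertex before it looks at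
    \<open>n - 1\<close> and \<open>n\<close>, so these labels must be shown to lie off the 3-cycles
    of both pieces.\<close>
  have no_compl_top: "\<nexists>j. complementary \<Gamma>1 \<Gamma>2 L i j" if "n - 1 \<le> i" for i
  proof
    assume "\<exists>j. complementary \<Gamma>1 \<Gamma>2 L i j"
    then obtain x y z where "three_cycle \<Gamma>1 {x, y, z} \<or> three_cycle \<Gamma>2 {x, y, z}" "L x = i"
      unfolding complementary_def by blast
    then have "x \<in> W" unfolding W_def using T1.three_cycleD(1) T2.three_cycleD(1) by blast
    then show False using LW(2) \<open>L x = i\<close> that n by fastforce
  qed
  have \<beta>_top: "beta n m \<alpha> \<Gamma>1 \<Gamma>2 L (n - 1) = \<epsilon> (m + 1) - \<epsilon> n" "beta n m \<alpha> \<Gamma>1 \<Gamma>2 L n = \<epsilon> (m + 1) + \<epsilon> n"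
    using no_compl_top[of "n - 1"] no_compl_top[of n] telescope[of "m + 1" "n - 2"] \<alpha>[of "n - 1"] \<alpha>_n m2 n
    unfolding beta_def by (auto simp: Suc_diff_Suc numeral_2_eq_2)
  \<comment> \<open>The labels \<open>n - 1\<close> and \<open>n\<close> may be given to
    \<open>a\<close> and \<open>b\<close> in either order; the sign treats both at once.\<close>
  obtain s :: real where s: "s = 1 \<or> s = - 1"
    and \<beta>_ab: "?\<beta> a = \<epsilon> (m + 1) + s *\<^sub>R \<epsilon> n" "?\<beta> b = \<epsilon> (m + 1) - s *\<^sub>R \<epsilon> n"
  proof (cases "L a = n")
    case True
    then have "L b = n - 1" using Lab by (auto simp: doubleton_eq_iff)
    then show ?thesis using that[of 1] \<beta>_top True by simp
  next
    case False
    then have "L a = n - 1" "L b = n" using Lab by (auto simp: doubleton_eq_iff)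
    then show ?thesis using that[of "- 1"] \<beta>_top by simp
  qed
  have rs: "root_system \<Phi>" "\<And>r. r \<in> \<Phi> \<Longrightarrow> r \<bullet> r = 2"
    using sys unfolding simply_laced_system_def by blast+
  note \<alpha>_root = simply_laced_simple_root[OF sys]
  \<comment> \<open>Simple roots are added one at a time: each partial sum has product -1 with the
    next one, so the reflection stays in \<open>\<Phi>\<close>.\<close>
  have minus_root: "\<epsilon> i - \<epsilon> j \<in> \<Phi>" if "1 \<le> i" "i < j" "j \<le> n" for i j
  proof -
    have "Suc i \<le> j" using that by simp
    then show ?thesis using that(3)
    proof (induction j rule: dec_induct)
      case base
      then show ?case using \<alpha>_root[of i] \<alpha>[of i] that by simp
    next
      case (step j)
      have "(\<epsilon> i - \<epsilon> j) \<bullet> \<alpha> j = - 1"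
        using step that(1) \<alpha>[of j] ortho by (simp add: inner_diff_left inner_diff_right)
      then have "(\<epsilon> i - \<epsilon> j) + \<alpha> j \<in> \<Phi>"
        using reflection_root[OF rs] step \<alpha>_root[of j] by simp
      then show ?case using \<alpha>[of j] step that(1) by simp
    qed
  qed
  have plus_root: "\<epsilon> i + \<epsilon> n \<in> \<Phi>" if "1 \<le> i" "i < n - 1" for i
  proof -
    have "(\<epsilon> i - \<epsilon> (n - 1)) \<bullet> \<alpha> n = - 1"
      using that \<alpha>_n ortho n by (auto simp: inner_diff_left inner_add_right)
    then have "(\<epsilon> i - \<epsilon> (n - 1)) + \<alpha> n \<in> \<Phi>"
      using reflection_root[OF rs] minus_root[of i "n - 1"] \<alpha>_root[of n] that n by simp
    then show ?thesis using \<alpha>_n by simp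
  qed
  have roots: "?\<beta> ` qverts \<Gamma> \<subseteq> \<Phi>"
  proof -
    have "?\<beta> x \<in> \<Phi>" if "x \<in> W" for x using \<beta>_W[OF that] minus_root LW[OF that] n by simp
    moreover have "?\<beta> a \<in> \<Phi>" "?\<beta> b \<in> \<Phi>"
      using s \<beta>_ab minus_root[of "m + 1" n] plus_root[of "m + 1"] m2 n by auto
    ultimately show ?thesis unfolding verts W_def by auto
  qed
  let ?S = "zmod.span (?\<beta> ` qverts \<Gamma>)"
  have \<beta>_span: "?\<beta> x \<in> ?S" if "x \<in> qverts \<Gamma>" for x using that by (auto intro: zmod.span_base)
  \<comment> \<open>Adding \<open>?\<beta> x\<close> trades the node \<open>L x\<close> for the
    larger node \<open>h x\<close>; since every label up to \<open>n - 2\<close> occurs, the climb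
    stops only at \<open>n - 1\<close>.\<close>
  have down: "\<epsilon> t - \<epsilon> (n - 1) \<in> ?S" if "1 \<le> t" "t \<le> n - 1" for t
    using that
  proof (induction "n - t" arbitrary: t rule: less_induct)
    case less
    show ?case
    proof (cases "t = n - 1")
      case True
      then show ?thesis by (simp add: zmod.span_zero)
    next
      case False
      then have "t \<le> n - 2" using less(3) by simp
      then obtain x where x: "x \<in> W" "L x = t" using surj[OF less(2)] by blast
      have "n - h x < n - t" "1 \<le> h x" "h x \<le> n - 1" using LW[OF x(1)] x(2) n by auto
      then have "\<epsilon> (h x) - \<epsilon> (n - 1) \<in> ?S" by (rule less(1))
      moreover have "?\<beta> x \<in> ?S" using \<beta>_span x(1) unfolding verts W_def by blast
      ultimately have "?\<beta> x + (\<epsilon> (h x) - \<epsilon> (n - 1)) \<in> ?S" using zmod.span_add by blast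
      then show ?thesis using \<beta>_W[OF x(1)] x(2) by simp
    qed
  qed
  have gen: "\<alpha> t \<in> ?S" if t: "t \<in> {1..n}" for t
  proof -
    have "a \<in> qverts \<Gamma>" "b \<in> qverts \<Gamma>" using verts by auto
    then have ab: "\<epsilon> (m + 1) + \<epsilon> n \<in> ?S" "\<epsilon> (m + 1) - \<epsilon> n \<in> ?S"
      using \<beta>_span[of a] \<beta>_span[of b] \<beta>_ab s by auto
    \<comment> \<open>Subtracting this from the two vectors in \<open>ab\<close> leaves
      \<open>\<epsilon> (n - 1) + \<epsilon> n\<close> and
      \<open>\<epsilon> (n - 1) - \<epsilon> n\<close>, the last two simple roots.\<close>
    have mid: "\<epsilon> (m + 1) - \<epsilon> (n - 1) \<in> ?S" using down[of "m + 1"] m2 n by simp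
    consider "t \<le> n - 2" | "t = n - 1" | "t = n" using t by fastforce
    then show ?thesis
    proof cases
      case 1
      then have "\<epsilon> t - \<epsilon> (n - 1) \<in> ?S" "\<epsilon> (t + 1) - \<epsilon> (n - 1) \<in> ?S" using down t n by auto
      from zmod.span_diff[OF this] show ?thesis using \<alpha>[of t] 1 t n by simp
    next
      case 2
      from zmod.span_diff[OF ab(2) mid] show ?thesis using \<alpha>[of t] 2 n by simp
    next
      case 3
      from zmod.span_diff[OF ab(1) mid] show ?thesis using \<alpha>_n 3 by (simp add: add.commute)
    qed
  qed
  have fin: "finite (qverts \<Gamma>)" using verts T1.finite_verts T2.finite_verts by simp
  have "card (qverts \<Gamma>1 \<union> qverts \<Gamma>2) = n - 2"
    using card_Un_disjoint[OF T1.finite_verts T2.finite_verts disj(1)] card m2 by simp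
  then have cardG: "card (qverts \<Gamma>) = n"
    using card_Un_disjoint[of "{a, b}" "qverts \<Gamma>1 \<union> qverts \<Gamma>2"] disj T1.finite_verts T2.finite_verts n
    unfolding verts by (simp add: Un_assoc)
  note basis = Z_basis_if_generates[OF sys fin cardG roots gen]
  have ip: "(\<epsilon> i - \<epsilon> j) \<bullet> (\<epsilon> k - \<epsilon> l) = of_bool (i = k) - of_bool (i = l) - of_bool (j = k) + of_bool (j = l)"
    if "i \<in> {1..n}" "j \<in> {1..n}" "k \<in> {1..n}" "l \<in> {1..n}" for i j k l
    using ortho that by (simp add: inner_diff_left inner_diff_right)
  have ip_n: "(\<epsilon> i - \<epsilon> j) \<bullet> (\<epsilon> k + c *\<^sub>R \<epsilon> n) = of_bool (i = k) - of_bool (j = k)"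
    if "i \<in> {1..<n}" "j \<in> {1..<n}" "k \<in> {1..<n}" for i j k c
    using ortho that by (simp add: inner_diff_left inner_add_right)
  have ip_ab: "?\<beta> a \<bullet> ?\<beta> b = 0"
    unfolding \<beta>_ab using ortho[of "m + 1" "m + 1"] ortho[of "m + 1" n] ortho[of n "m + 1"] ortho[of n n] s m2 n
    by (auto simp: inner_add_left inner_diff_right)
  define DT where "DT = double_triangle v1 v2 a b"
  have num: "num_edges \<Gamma> x y = num_edges DT x y + num_edges \<Gamma>1 x y + num_edges \<Gamma>2 x y" for x y
    unfolding num_edges_def arr DT_def by simp
  have num0: "num_edges \<Gamma>1 x y = 0" if "x \<notin> qverts \<Gamma>1 \<or> y \<notin> qverts \<Gamma>1" for x y
    using T1.adjacent_iff[of x y] that by auto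
  have num0': "num_edges \<Gamma>2 x y = 0" if "x \<notin> qverts \<Gamma>2 \<or> y \<notin> qverts \<Gamma>2" for x y
    using T2.adjacent_iff[of x y] that by auto
  have vW: "v1 \<in> W" "v2 \<in> W" "v1 \<noteq> v2" "a \<notin> W" "b \<notin> W" using ends disj unfolding W_def by auto
  have dt_W: "num_edges DT x y = of_bool (x = v1 \<and> y = v2 \<or> x = v2 \<and> y = v1)" if "x \<in> W" "y \<in> W" for x y
  proof -
    have "arrows DT x y = of_bool (x = v2 \<and> y = v1)" if "x \<in> W" "y \<in> W" for x y
    proof -
      have "x \<noteq> a" "x \<noteq> b" "y \<noteq> a" "y \<noteq> b" using that vW by auto
      then show ?thesis unfolding DT_def double_triangle_def by simp
    qed
    from this[OF that] this[OF that(2,1)] show ?thesis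
      using vW(3) unfolding num_edges_def by (cases "x = v1") auto
  qed
  have dt_ab: "num_edges DT x y = of_bool (x = v1 \<or> x = v2)" if "x \<in> W" "y \<in> {a, b}" for x y
  proof -
    have ne: "x \<noteq> a" "x \<noteq> b" "y \<noteq> v1" "y \<noteq> v2" using that vW by auto
    have "arrows DT x y = of_bool (x = v1)" "arrows DT y x = of_bool (x = v2)"
      using ne that(2) unfolding DT_def double_triangle_def by auto
    then show ?thesis using vW(3) unfolding num_edges_def by (cases "x = v1") auto
  qed
  have dt_top: "num_edges DT a b = 0"
  proof -
    have "a \<noteq> v1" "a \<noteq> v2" "b \<noteq> v1" "b \<noteq> v2" using vW by auto
    then show ?thesis unfolding num_edges_def DT_def double_triangle_def by simp
  qed
  \<comment> \<open>Distinct lower ends rule out two common nodes, so at most one term survives. It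
    is negative when one edge ends where the other begins, which the absolute value absorbs.\<close>
  have shared: "\<bar>of_bool (i = k) - of_bool (i = l) - of_bool (j = k) + of_bool (j = l)\<bar>
      = real (if {i, j} \<inter> {k, l} = {} then 0 else 1)" if "i < j" "k < l" "i \<noteq> k" for i j k l :: nat
    using that by auto
  have ip_W: "?\<beta> x \<bullet> ?\<beta> y = of_bool (L x = L y) - of_bool (L x = h y) - of_bool (h x = L y) + of_bool (h x = h y)"
    if "x \<in> W" "y \<in> W" for x y
    using ip[of "L x" "h x" "L y" "h y"] \<beta>_W LW[OF that(1)] LW[OF that(2)] that n by simp
  have ip_Wab: "?\<beta> x \<bullet> ?\<beta> y = of_bool (L x = m + 1) - of_bool (h x = m + 1)"
    if "x \<in> W" "y \<in> {a, b}" for x y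
    using ip_n[of "L x" "h x" "m + 1" s] ip_n[of "L x" "h x" "m + 1" "- s"] \<beta>_W \<beta>_ab LW[OF that(1)] that m2 n
    by auto
  \<comment> \<open>Both sides are symmetric in \<open>x\<close> and \<open>y\<close>, so each kind
    of pair is treated in one order only.\<close>
  have half_edges: "\<bar>?\<beta> x \<bullet> ?\<beta> y\<bar> = real (num_edges \<Gamma> x y)"
    if xy: "x \<in> qverts \<Gamma>1 \<and> y \<in> W \<union> {a, b} \<or> x \<in> qverts \<Gamma>2 \<and> y \<in> qverts \<Gamma>2 \<union> {a, b} \<or> x = a \<and> y = b"
      and "x \<noteq> y" for x y
  proof -
    consider "x \<in> qverts \<Gamma>1" "y \<in> qverts \<Gamma>1" | "x \<in> qverts \<Gamma>2" "y \<in> qverts \<Gamma>2" | "x \<in> qverts \<Gamma>1" "y \<in> qverts \<Gamma>2"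
      | "x \<in> qverts \<Gamma>1" "y \<in> {a, b}" | "x \<in> qverts \<Gamma>2" "y \<in> {a, b}" | "x = a" "y = b"
      using xy unfolding W_def by blast
    then show ?thesis
    proof cases
      case 1
      then have W: "x \<in> W" "y \<in> W" unfolding W_def by auto
      have "x \<noteq> v2" "y \<noteq> v2" using 1 ends disj by auto
      then have "num_edges \<Gamma> x y = num_edges \<Gamma>1 x y"
        using num[of x y] dt_W[OF W] num0'[of x y] 1 disj by auto
      then have "num_edges \<Gamma> x y = (if {L x, h x} \<inter> {L y, h y} = {} then 0 else 1)"
        using D1(7)[OF 1 \<open>x \<noteq> y\<close>] 1 unfolding h_def by simp
      moreover have "L x \<noteq> L y" using tree_labelling_inj[OF tl1 1] \<open>x \<noteq> y\<close> by simp
      ultimately show ?thesis using shared[OF LW(3)[OF W(1)] LW(3)[OF W(2)]] ip_W[OF W] by simp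
    next
      case 2
      then have W: "x \<in> W" "y \<in> W" unfolding W_def by auto
      have "x \<noteq> v1" "y \<noteq> v1" and not1: "x \<notin> qverts \<Gamma>1" "y \<notin> qverts \<Gamma>1" using 2 ends disj by auto
      then have "num_edges \<Gamma> x y = num_edges \<Gamma>2 x y"
        using num[of x y] dt_W[OF W] num0[of x y] by auto
      then have "num_edges \<Gamma> x y = (if {L x, h x} \<inter> {L y, h y} = {} then 0 else 1)"
        using D2(7)[OF 2 \<open>x \<noteq> y\<close>] not1 unfolding h_def by simp
      moreover have "L x \<noteq> L y" using tree_labelling_inj[OF tl2 2] \<open>x \<noteq> y\<close> by simp
      ultimately show ?thesis using shared[OF LW(3)[OF W(1)] LW(3)[OF W(2)]] ip_W[OF W] by simp
    next
      case 3
      then have W: "x \<in> W" "y \<in> W" unfolding W_def by auto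
      have "x \<notin> qverts \<Gamma>2" "y \<notin> qverts \<Gamma>1" "x \<noteq> v2" "y \<noteq> v1" using 3 ends disj by auto
      then have "num_edges \<Gamma> x y = of_bool (x = v1 \<and> y = v2)"
        using num[of x y] dt_W[OF W] num0[of x y] num0'[of x y] by simp
      \<comment> \<open>Across the two pieces the only common node is \<open>m + 1\<close>, the
        upper end of \<open>v1\<close> and the lower end of \<open>v2\<close>; it accounts for the
        arrow from \<open>v2\<close> to \<open>v1\<close>.\<close>
      moreover have "h x = L y \<longleftrightarrow> x = v1 \<and> y = v2" "L x \<noteq> L y" "L x \<noteq> h y" "h x \<noteq> h y"
        using L1[OF 3(1)] L2[OF 3(2)] by auto
      ultimately show ?thesis using ip_W[OF W] by simp
    next
      case 4
      then have W: "x \<in> W" unfolding W_def by auto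
      have "x \<notin> qverts \<Gamma>2" "y \<notin> qverts \<Gamma>1" "x \<noteq> v2" using 4 ends disj by auto
      then have "num_edges \<Gamma> x y = of_bool (x = v1)"
        using num[of x y] dt_ab[OF W 4(2)] num0[of x y] num0'[of x y] by simp
      moreover have "h x = m + 1 \<longleftrightarrow> x = v1" "L x \<noteq> m + 1" using L1[OF 4(1)] by auto
      ultimately show ?thesis using ip_Wab[OF W 4(2)] by simp
    next
      case 5
      then have W: "x \<in> W" unfolding W_def by auto
      have "x \<notin> qverts \<Gamma>1" "y \<notin> qverts \<Gamma>2" "x \<noteq> v1" using 5 ends disj by auto
      then have "num_edges \<Gamma> x y = of_bool (x = v2)"
        using num[of x y] dt_ab[OF W 5(2)] num0[of x y] num0'[of x y] by simp
      moreover have "L x = m + 1 \<longleftrightarrow> x = v2" "h x \<noteq> m + 1" using L2[OF 5(1)] by auto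
      ultimately show ?thesis using ip_Wab[OF W 5(2)] by simp
    next
      case 6
      have "num_edges \<Gamma> a b = 0" using num[of a b] dt_top num0[of a b] num0'[of a b] vW unfolding W_def by simp
      then show ?thesis using 6 ip_ab by simp
    qed
  qed
  have edges: "\<bar>?\<beta> x \<bullet> ?\<beta> y\<bar> = real (num_edges \<Gamma> x y)"
    if "x \<in> qverts \<Gamma>" "y \<in> qverts \<Gamma>" "x \<noteq> y" for x y
  proof -
    have "?\<beta> x \<bullet> ?\<beta> y = ?\<beta> y \<bullet> ?\<beta> x" "num_edges \<Gamma> x y = num_edges \<Gamma> y x"
      by (rule inner_commute, rule num_edges_commute)
    then show ?thesis using half_edges[of x y] half_edges[of y x] that unfolding verts W_def by auto
  qed
  show ?thesis
    unfolding companion_basis_def using assms(3) sys roots basis edges by blast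
qed

end
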